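(* Suppose $\psi(M_1)=0$, let $\xi\in\mathbb{C}$, and put $\eta_1=\psi(L_1)$, $\eta_2=\psi(L_2)$, $\eta_3=\psi(Y_{\frac12})$. Define $z\in U(\mathfrak{sv})$ by: $z=L_0$ if $\eta_1=\eta_2=\eta_3=0$; $$z=\xi^2L_0-\xi\eta_2M_{-2}-\xi\eta_1M_{-1}+\eta_2M_{-1}^2-\xi\frac{\eta_3}{2}Y_{-\frac12}+\frac{\eta_3^2}{2}M_{-1}$$ if $\eta_2\neq 0$ or $\eta_3\neq 0$; and $z=\xi L_0-\eta_1M_{-1}$ otherwise (i.e. $\eta_2=\eta_3=0$, $\eta_1\neq0$). Then for every $u\in\mathbb{C}[z]$, the vector $u\bar w$ is a Whittaker vector of $L_{\psi,\xi}$, where $\bar w=\overline{1\otimes1}$; that is, $x(u\bar w)=\psi(x)u\bar w$ for all $x\in\mathfrak{sv}^+$.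
   Context: The Schrödinger-Virasoro algebra $\mathfrak{sv}$ is the complex Lie algebra with basis $\{L_n,M_n,Y_{n+\frac12}\mid n\in\mathbb{Z}\}$ and brackets, for $m,n\in\mathbb{Z}$: $[L_m,L_n]=(n-m)L_{m+n}$, $[L_m,M_n]=nM_{m+n}$, $[L_m,Y_{n+\frac12}]=(n+\frac{1-m}{2})Y_{m+n+\frac12}$, $[Y_{m+\frac12},Y_{n+\frac12}]=(n-m)M_{m+n+1}$, $[M_m,M_n]=[M_m,Y_{n+\frac12}]=0$. The element $M_0$ is central. Put $\mathfrak{sv}^+=\mathrm{span}_{\mathbb{C}}\{L_n,M_n,Y_{m+\frac12}\mid n\geq 1,\ m\geq 0\}$. Let $\psi:\mathfrak{sv}^+\to\mathbb{C}$ be a Lie algebra homomorphism; throughout, $\psi(L_n)=0$ for $n\geq 3$, $\psi(M_m)=0$ for $m\geq 2$, and $\psi(Y_{\frac12+k})=0$ for $k\geq 1$. Let $\mathbb{C}_\psi$ be the one-dimensional $\mathfrak{sv}^+$-module with $x\alpha=\psi(x)\alpha$, let $W_\psi=U(\mathfrak{sv})\otimes_{U(\mathfrak{sv}^+)}\mathbb{C}_\psi$, and for $\xi\in\mathbb{C}$ let $L_{\psi,\xi}=W_\psi/(M_0-\xi)W_\psi$; $\overline{1\otimes1}$ denotes the image of $1\otimes 1$. $\mathbb{C}[z]$ denotes the subalgebra of $U(\mathfrak{sv})$ generated by $z$. *)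

theory Defs
  imports Complex_Main "HOL-Library.Poly_Mapping" "HOL-Computational_Algebra.Group_Closure"
begin

section \<open>Complex vector spaces, algebras and Lie algebras\<close>

class complex_vec = ab_group_add +
  fixes cscale :: "complex \<Rightarrow> 'a \<Rightarrow> 'a"  (infixr \<open>*\<^sub>c\<close> 75)
  assumes cscale_add_right: "c *\<^sub>c (x + y) = c *\<^sub>c x + c *\<^sub>c y"
    and cscale_add_left: "(c + d) *\<^sub>c x = c *\<^sub>c x + d *\<^sub>c x"
    and cscale_cscale: "c *\<^sub>c d *\<^sub>c x = (c * d) *\<^sub>c x"
    and cscale_one: "1 *\<^sub>c x = x"

class complex_alg = complex_vec + ring_1 +
  assumes cscale_mult_left: "(c *\<^sub>c x) * y = c *\<^sub>c (x * y)"
    and cscale_mult_right: "x * (c *\<^sub>c y) = c *\<^sub>c (x * y)"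

class lie_algebra = complex_vec +
  fixes bracket :: "'a \<Rightarrow> 'a \<Rightarrow> 'a"
  assumes bracket_add_left: "bracket (x + y) z = bracket x z + bracket y z"
    and bracket_add_right: "bracket x (y + z) = bracket x y + bracket x z"
    and bracket_cscale_left: "bracket (c *\<^sub>c x) y = c *\<^sub>c bracket x y"
    and bracket_cscale_right: "bracket x (c *\<^sub>c y) = c *\<^sub>c bracket x y"
    and bracket_self: "bracket x x = 0"
    and bracket_jacobi:
      "bracket x (bracket y z) + bracket y (bracket z x) + bracket z (bracket x y) = 0"

global_interpretation cvec: vector_space "cscale :: complex \<Rightarrow> 'a::complex_vec \<Rightarrow> 'a"
  by standard (simp_all add: cscale_add_right cscale_add_left cscale_cscale cscale_one)

definition lie_hom :: "('g::lie_algebra \<Rightarrow> 'h::lie_algebra) \<Rightarrow> bool" where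
  "lie_hom f \<longleftrightarrow> Vector_Spaces.linear cscale cscale f \<and>
     (\<forall>x y. f (bracket x y) = bracket (f x) (f y))"

text \<open>The complex numbers, as a one-dimensional algebra and as an abelian Lie algebra.\<close>

instantiation complex :: "{complex_alg, lie_algebra}"
begin

definition cscale_complex :: "complex \<Rightarrow> complex \<Rightarrow> complex" where
  "cscale_complex c x = c * x"

definition bracket_complex :: "complex \<Rightarrow> complex \<Rightarrow> complex" where
  "bracket_complex x y = 0"

instance
  by standard (simp_all add: cscale_complex_def bracket_complex_def algebra_simps)

end

instantiation poly_mapping :: (type, complex_vec) complex_vec
begin

lift_definition cscale_poly_mapping :: "complex \<Rightarrow> ('a \<Rightarrow>\<^sub>0 'b) \<Rightarrow> ('a \<Rightarrow>\<^sub>0 'b)"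
  is "\<lambda>c f k. c *\<^sub>c f k"
  by (rule finite_subset[rotated]) auto

instance
  by standard (transfer; simp add: fun_eq_iff cscale_add_right cscale_add_left cscale_cscale cscale_one)+

end

lemma lookup_cscale [simp]: "Poly_Mapping.lookup (c *\<^sub>c p) k = c *\<^sub>c Poly_Mapping.lookup p k"
  by transfer simp

lemma cscale_sum: "c *\<^sub>c (\<Sum>i\<in>A. f i) = (\<Sum>i\<in>A. c *\<^sub>c f i)"
  by (rule cvec.scale_sum_right)

text \<open>Linear extension of a map given on a basis.\<close>

definition lin_ext :: "('b \<Rightarrow> 'v::complex_vec) \<Rightarrow> ('b \<Rightarrow>\<^sub>0 complex) \<Rightarrow> 'v" where
  "lin_ext f p = (\<Sum>k\<in>Poly_Mapping.keys p. Poly_Mapping.lookup p k *\<^sub>c f k)"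

lemma lin_ext_superset:
  assumes "finite A" "Poly_Mapping.keys p \<subseteq> A"
  shows "lin_ext f p = (\<Sum>k\<in>A. Poly_Mapping.lookup p k *\<^sub>c f k)"
  unfolding lin_ext_def using assms
  by (intro sum.mono_neutral_left) (auto simp: in_keys_iff)

lemma lin_ext_add: "lin_ext f (p + q) = lin_ext f p + lin_ext f q"
proof -
  let ?A = "Poly_Mapping.keys p \<union> Poly_Mapping.keys q"
  have "lin_ext f (p + q) = (\<Sum>k\<in>?A. Poly_Mapping.lookup (p + q) k *\<^sub>c f k)"
    by (rule lin_ext_superset) (use Poly_Mapping.keys_add[of p q] in auto)
  moreover have "lin_ext f p = (\<Sum>k\<in>?A. Poly_Mapping.lookup p k *\<^sub>c f k)"
    by (rule lin_ext_superset) auto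
  moreover have "lin_ext f q = (\<Sum>k\<in>?A. Poly_Mapping.lookup q k *\<^sub>c f k)"
    by (rule lin_ext_superset) auto
  ultimately show ?thesis
    by (simp add: lookup_add cscale_add_left sum.distrib)
qed

lemma lin_ext_cscale: "lin_ext f (c *\<^sub>c p) = c *\<^sub>c lin_ext f p"
proof -
  have "lin_ext f (c *\<^sub>c p) = (\<Sum>k\<in>Poly_Mapping.keys p. Poly_Mapping.lookup (c *\<^sub>c p) k *\<^sub>c f k)"
    by (rule lin_ext_superset) (auto simp: in_keys_iff)
  then show ?thesis
    by (simp add: lin_ext_def cscale_sum cscale_cscale cscale_complex_def)
qed

lemma lin_ext_single [simp]: "lin_ext f (Poly_Mapping.single k c) = c *\<^sub>c f k"
  by (cases "c = 0") (simp_all add: lin_ext_def)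

lemma lin_ext_zero [simp]: "lin_ext f 0 = 0"
  by (simp add: lin_ext_def)

lemma lin_ext_uminus: "lin_ext f (- p) = - lin_ext f p"
  using lin_ext_add[of f p "- p"] by (simp add: eq_neg_iff_add_eq_0 add.commute)

lemma lin_ext_diff: "lin_ext f (p - q) = lin_ext f p - lin_ext f q"
  using lin_ext_add[of f p "- q"] by (simp add: lin_ext_uminus)

lemma lin_ext_add_fun: "lin_ext (\<lambda>k. f k + g k) p = lin_ext f p + lin_ext g p"
  by (simp add: lin_ext_def cscale_add_right sum.distrib)

lemma lin_ext_cscale_fun: "lin_ext (\<lambda>k. c *\<^sub>c f k) p = c *\<^sub>c lin_ext f p"
  by (simp add: lin_ext_def cscale_sum cscale_cscale mult.commute)

lemma single_add_induct [case_names single sum]: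
  fixes p :: "'b \<Rightarrow>\<^sub>0 'c::comm_monoid_add"
  assumes "\<And>k v. P (Poly_Mapping.single k v)" "\<And>p q. P p \<Longrightarrow> P q \<Longrightarrow> P (p + q)"
  shows "P p"
proof (induction p rule: Poly_Mapping.update_induct)
  case const
  then show ?case using assms(1)[of undefined 0] by simp
next
  case (update f a b)
  have "Poly_Mapping.update a b f = Poly_Mapping.single a b + f"
    by (rule poly_mapping_eqI)
      (use update in \<open>auto simp: lookup_update lookup_add lookup_single in_keys_iff\<close>)
  then show ?case using assms update by simp
qed

lemma basis_induct [case_names single add]:
  fixes p :: "'b \<Rightarrow>\<^sub>0 complex"
  assumes "\<And>c k. P (c *\<^sub>c Poly_Mapping.single k 1)" "\<And>p q. P p \<Longrightarrow> P q \<Longrightarrow> P (p + q)"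
  shows "P p"
proof (induction p rule: single_add_induct)
  case (single k v)
  have "Poly_Mapping.single k v = v *\<^sub>c Poly_Mapping.single k 1"
    by (rule poly_mapping_eqI) (simp add: lookup_single cscale_complex_def when_def)
  then show ?case using assms(1) by simp
next
  case (sum p q)
  then show ?case using assms(2) by blast
qed

section \<open>The universal enveloping algebra\<close>

text \<open>The free monoid, written additively so that finitely supported functions on it
  carry the convolution product of the library: \<open>'g fmon \<Rightarrow>\<^sub>0 complex\<close> is the free associative
  algebra on the set \<open>'g\<close>.\<close>

datatype 'g fmon = FMon (letters: "'g list")

instantiation fmon :: (type) monoid_add
begin

definition zero_fmon :: "'a fmon" where "zero_fmon = FMon []"

definition plus_fmon :: "'a fmon \<Rightarrow> 'a fmon \<Rightarrow> 'a fmon" where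
  "plus_fmon v w = FMon (letters v @ letters w)"

instance
  by standard (simp_all add: zero_fmon_def plus_fmon_def)

end

instance poly_mapping :: (monoid_add, complex_alg) complex_alg
proof
  fix c :: complex and p q :: "'a \<Rightarrow>\<^sub>0 'b"
  have single: "c *\<^sub>c r = Poly_Mapping.single 0 (c *\<^sub>c 1) * r" for r :: "'a \<Rightarrow>\<^sub>0 'b"
  proof (induction r rule: single_add_induct)
    case (single k v)
    show ?case
      by (rule poly_mapping_eqI)
        (simp add: mult_single lookup_single cscale_mult_left when_def cvec.scale_zero_right)
  next
    case (sum p q)
    then show ?case by (simp add: cscale_add_right distrib_left)
  qed
  have single': "c *\<^sub>c r = r * Poly_Mapping.single 0 (c *\<^sub>c 1)" for r :: "'a \<Rightarrow>\<^sub>0 'b"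
  proof (induction r rule: single_add_induct)
    case (single k v)
    show ?case
      by (rule poly_mapping_eqI)
        (simp add: mult_single lookup_single cscale_mult_right when_def cvec.scale_zero_right)
  next
    case (sum p q)
    then show ?case by (simp add: cscale_add_right distrib_right)
  qed
  show "(c *\<^sub>c p) * q = c *\<^sub>c (p * q)"
    by (simp only: single mult.assoc)
  show "p * (c *\<^sub>c q) = c *\<^sub>c (p * q)"
    by (simp only: single' mult.assoc)
qed

text \<open>The two-sided ideal generated by a set.\<close>

inductive_set ideal_hull :: "'a::ring_1 set \<Rightarrow> 'a set" for S where
  zero: "0 \<in> ideal_hull S"
| base: "a \<in> S \<Longrightarrow> a \<in> ideal_hull S"
| add: "a \<in> ideal_hull S \<Longrightarrow> b \<in> ideal_hull S \<Longrightarrow> a + b \<in> ideal_hull S"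
| lmult: "a \<in> ideal_hull S \<Longrightarrow> r * a \<in> ideal_hull S"
| rmult: "a \<in> ideal_hull S \<Longrightarrow> a * r \<in> ideal_hull S"

lemma ideal_hull_uminus: "a \<in> ideal_hull S \<Longrightarrow> - a \<in> ideal_hull S"
  using ideal_hull.lmult[of a S "- 1"] by simp

lemma ideal_hull_diff: "a \<in> ideal_hull S \<Longrightarrow> b \<in> ideal_hull S \<Longrightarrow> a - b \<in> ideal_hull S"
  using ideal_hull.add[of a S "- b"] by (simp add: ideal_hull_uminus)

lemma ideal_hull_diff_trans:
  "a - b \<in> ideal_hull S \<Longrightarrow> b - c \<in> ideal_hull S \<Longrightarrow> a - c \<in> ideal_hull S"
  using ideal_hull.add[of "a - b" S "b - c"] by simp

definition letter :: "'g \<Rightarrow> ('g fmon \<Rightarrow>\<^sub>0 complex)" where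
  "letter x = Poly_Mapping.single (FMon [x]) 1"

text \<open>The first two families of relations make the free algebra on the underlying set into the
  tensor algebra; the third one imposes \<open>x y - y x = [x, y]\<close>.\<close>

definition uea_relations :: "('g::lie_algebra fmon \<Rightarrow>\<^sub>0 complex) set" where
  "uea_relations =
     {letter (x + y) - letter x - letter y | x y. True} \<union>
     {letter (c *\<^sub>c x) - c *\<^sub>c letter x | c x. True} \<union>
     {letter x * letter y - letter y * letter x - letter (bracket x y) | x y. True}"

definition uea_eq :: "('g::lie_algebra fmon \<Rightarrow>\<^sub>0 complex) \<Rightarrow> ('g fmon \<Rightarrow>\<^sub>0 complex) \<Rightarrow> bool" where
  "uea_eq p q \<longleftrightarrow> p - q \<in> ideal_hull uea_relations"

lemma equivp_uea_eq: "equivp uea_eq"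
proof (rule equivpI)
  show "reflp uea_eq" by (simp add: reflp_def uea_eq_def ideal_hull.zero)
  show "symp uea_eq"
    unfolding symp_def uea_eq_def using ideal_hull_uminus by fastforce
  show "transp uea_eq"
    unfolding transp_def uea_eq_def using ideal_hull_diff_trans by blast
qed

quotient_type (overloaded) 'g uea = "'g::lie_algebra fmon \<Rightarrow>\<^sub>0 complex" / uea_eq
  by (rule equivp_uea_eq)

instantiation uea :: (lie_algebra) complex_alg
begin

lift_definition zero_uea :: "'a uea" is 0 .

lift_definition one_uea :: "'a uea" is 1 .

lift_definition plus_uea :: "'a uea \<Rightarrow> 'a uea \<Rightarrow> 'a uea" is "(+)"
  unfolding uea_eq_def by (simp only: add_diff_add ideal_hull.add)

lift_definition uminus_uea :: "'a uea \<Rightarrow> 'a uea" is uminus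
  unfolding uea_eq_def by (simp only: minus_diff_minus ideal_hull_uminus)

lift_definition minus_uea :: "'a uea \<Rightarrow> 'a uea \<Rightarrow> 'a uea" is "(-)"
proof -
  fix p p' q q' :: "'a fmon \<Rightarrow>\<^sub>0 complex"
  assume "uea_eq p p'" "uea_eq q q'"
  then have "(p - p') - (q - q') \<in> ideal_hull uea_relations"
    unfolding uea_eq_def by (rule ideal_hull_diff)
  then show "uea_eq (p - q) (p' - q')"
    unfolding uea_eq_def by (simp add: algebra_simps)
qed

lift_definition times_uea :: "'a uea \<Rightarrow> 'a uea \<Rightarrow> 'a uea" is "(*)"
proof -
  fix p p' q q' :: "'a fmon \<Rightarrow>\<^sub>0 complex"
  assume "uea_eq p p'" "uea_eq q q'"
  then have "(p - p') * q + p' * (q - q') \<in> ideal_hull uea_relations"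
    unfolding uea_eq_def by (intro ideal_hull.add ideal_hull.lmult ideal_hull.rmult)
  then show "uea_eq (p * q) (p' * q')"
    unfolding uea_eq_def by (simp add: algebra_simps)
qed

lift_definition cscale_uea :: "complex \<Rightarrow> 'a uea \<Rightarrow> 'a uea" is cscale
proof -
  fix c :: complex and p q :: "'a fmon \<Rightarrow>\<^sub>0 complex"
  assume "uea_eq p q"
  then have "(c *\<^sub>c 1) * (p - q) \<in> ideal_hull uea_relations"
    unfolding uea_eq_def by (rule ideal_hull.lmult)
  then show "uea_eq (c *\<^sub>c p) (c *\<^sub>c q)"
    unfolding uea_eq_def by (simp add: cscale_mult_left cvec.scale_right_diff_distrib)
qed

text \<open>Nontriviality of the quotient (an instance requirement): the augmentation, sending every
  letter to zero, annihilates the relations.\<close>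

instance
proof
  fix a b c :: "'a uea" and x y :: complex
  show "a + b + c = a + (b + c)" by transfer (simp add: uea_eq_def ideal_hull.zero add.assoc)
  show "a + b = b + a" by transfer (simp add: uea_eq_def ideal_hull.zero add.commute)
  show "0 + a = a" by transfer (simp add: uea_eq_def ideal_hull.zero)
  show "- a + a = 0" by transfer (simp add: uea_eq_def ideal_hull.zero)
  show "a - b = a + - b" by transfer (simp add: uea_eq_def ideal_hull.zero)
  show "a * b * c = a * (b * c)" by transfer (simp add: uea_eq_def ideal_hull.zero mult.assoc)
  show "1 * a = a" by transfer (simp add: uea_eq_def ideal_hull.zero)
  show "a * 1 = a" by transfer (simp add: uea_eq_def ideal_hull.zero)
  show "(a + b) * c = a * c + b * c"
    by transfer (simp add: uea_eq_def ideal_hull.zero distrib_right)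
  show "a * (b + c) = a * b + a * c"
    by transfer (simp add: uea_eq_def ideal_hull.zero distrib_left)
  show "x *\<^sub>c (a + b) = x *\<^sub>c a + x *\<^sub>c b"
    by transfer (simp add: uea_eq_def ideal_hull.zero cscale_add_right)
  show "(x + y) *\<^sub>c a = x *\<^sub>c a + y *\<^sub>c a"
    by transfer (simp add: uea_eq_def ideal_hull.zero cscale_add_left)
  show "x *\<^sub>c y *\<^sub>c a = (x * y) *\<^sub>c a"
    by transfer (simp add: uea_eq_def ideal_hull.zero cscale_cscale)
  show "1 *\<^sub>c a = a" by transfer (simp add: uea_eq_def ideal_hull.zero cscale_one)
  show "(x *\<^sub>c a) * b = x *\<^sub>c (a * b)"
    by transfer (simp add: uea_eq_def ideal_hull.zero cscale_mult_left)
  show "a * (x *\<^sub>c b) = x *\<^sub>c (a * b)"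
    by transfer (simp add: uea_eq_def ideal_hull.zero cscale_mult_right)
  show "(0::'a uea) \<noteq> 1"
  proof transfer
    let ?e = "\<lambda>p :: 'a fmon \<Rightarrow>\<^sub>0 complex. Poly_Mapping.lookup p 0"
    have mult: "?e (p * q) = ?e p * ?e q" for p q
    proof (induction p rule: single_add_induct)
      case (single v c)
      show ?case
      proof (induction q rule: single_add_induct)
        case (single w d)
        show ?case
          by (cases v; cases w) (simp add: mult_single lookup_single when_def zero_fmon_def plus_fmon_def)
      qed (simp add: distrib_left lookup_add)
    qed (simp add: distrib_right lookup_add)
    have letter0: "?e (letter x) = 0" for x :: 'a
      by (simp add: letter_def lookup_single zero_fmon_def)
    have "?e p = 0" if "p \<in> ideal_hull uea_relations" for p
      using that
    proof induction
      case (base a)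
      then show ?case
        by (auto simp: uea_relations_def lookup_minus mult letter0 cscale_complex_def)
    qed (simp_all add: lookup_add mult)
    then have "?e (0 - 1) = 0" if "uea_eq (0 :: 'a fmon \<Rightarrow>\<^sub>0 complex) 1"
      using that unfolding uea_eq_def by blast
    then show "\<not> uea_eq (0 :: 'a fmon \<Rightarrow>\<^sub>0 complex) 1"
      by (auto simp: lookup_minus lookup_one)
  qed
qed

end

text \<open>The canonical map of a Lie algebra into its enveloping algebra.\<close>

lift_definition uea_of :: "'g::lie_algebra \<Rightarrow> 'g uea" is letter .

text \<open>The extension of a Lie algebra map \<open>\<phi>\<close> into an associative algebra (with its commutator
  bracket) to the enveloping algebra: the word \<open>x\<^sub>1 \<cdots> x\<^sub>k\<close> goes to \<open>\<phi> x\<^sub>1 \<cdots> \<phi> x\<^sub>k\<close>.  The value does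
  not depend on the representative if \<open>\<phi>\<close> is such a map; see \<open>uea_lift\<close> below.\<close>

definition free_ev :: "('g \<Rightarrow> 'a::complex_alg) \<Rightarrow> ('g fmon \<Rightarrow>\<^sub>0 complex) \<Rightarrow> 'a" where
  "free_ev \<phi> = lin_ext (\<lambda>w. prod_list (map \<phi> (letters w)))"

definition uea_lift :: "('g::lie_algebra \<Rightarrow> 'a::complex_alg) \<Rightarrow> 'g uea \<Rightarrow> 'a" where
  "uea_lift \<phi> u = free_ev \<phi> (rep_uea u)"

definition assoc_lie_hom :: "('g::lie_algebra \<Rightarrow> 'a::complex_alg) \<Rightarrow> bool" where
  "assoc_lie_hom \<phi> \<longleftrightarrow> Vector_Spaces.linear cscale cscale \<phi> \<and>
     (\<forall>x y. \<phi> (bracket x y) = \<phi> x * \<phi> y - \<phi> y * \<phi> x)"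

lemma free_ev_one: "free_ev \<phi> 1 = 1"
  by (simp add: free_ev_def cscale_one zero_fmon_def flip: single_one)

lemma free_ev_letter: "free_ev \<phi> (letter x) = \<phi> x"
  by (simp add: free_ev_def letter_def cscale_one)

lemma free_ev_mult: "free_ev \<phi> (p * q) = free_ev \<phi> p * free_ev \<phi> q"
proof (induction p rule: single_add_induct)
  case (single v c)
  show ?case
  proof (induction q rule: single_add_induct)
    case (single w d)
    show ?case
      by (simp add: free_ev_def mult_single plus_fmon_def cscale_mult_left cscale_mult_right
          cscale_cscale)
  qed (simp add: free_ev_def lin_ext_add distrib_left)
qed (simp add: free_ev_def lin_ext_add distrib_right)

lemma free_ev_ideal:
  assumes \<phi>: "assoc_lie_hom \<phi>" and "p \<in> ideal_hull uea_relations"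
  shows "free_ev \<phi> p = 0"
  using assms(2)
proof induction
  case (base a)
  have lin: "\<phi> (x + y) = \<phi> x + \<phi> y" "\<phi> (c *\<^sub>c x) = c *\<^sub>c \<phi> x" for x y c
    using \<phi> unfolding assoc_lie_hom_def by (auto simp: Vector_Spaces.linear_iff)
  have d: "free_ev \<phi> (p - q) = free_ev \<phi> p - free_ev \<phi> q" for p q
    by (simp add: free_ev_def lin_ext_diff)
  have s: "free_ev \<phi> (c *\<^sub>c p) = c *\<^sub>c free_ev \<phi> p" for c p
    by (simp add: free_ev_def lin_ext_cscale)
  from base show ?case
    using \<phi> unfolding uea_relations_def assoc_lie_hom_def
    by (auto simp: d s free_ev_letter free_ev_mult lin)
qed (simp_all add: free_ev_mult free_ev_def lin_ext_add free_ev_mult[unfolded free_ev_def])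

lemma uea_lift_abs:
  assumes "assoc_lie_hom \<phi>"
  shows "uea_lift \<phi> (abs_uea p) = free_ev \<phi> p"
proof -
  have "uea_eq (rep_uea (abs_uea p)) p"
    by (simp add: uea.abs_eq_iff[symmetric] Quotient_abs_rep[OF Quotient_uea])
  then have "free_ev \<phi> (rep_uea (abs_uea p) - p) = 0"
    using free_ev_ideal[OF assms] by (simp add: uea_eq_def)
  then show ?thesis by (simp add: uea_lift_def free_ev_def lin_ext_diff)
qed

lemma uea_lift:
  assumes "assoc_lie_hom \<phi>"
  shows "uea_lift \<phi> (uea_of x) = \<phi> x"
    and "uea_lift \<phi> 1 = 1"
    and "uea_lift \<phi> (u + v) = uea_lift \<phi> u + uea_lift \<phi> v"
    and "uea_lift \<phi> (u * v) = uea_lift \<phi> u * uea_lift \<phi> v"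
    and "uea_lift \<phi> (c *\<^sub>c u) = c *\<^sub>c uea_lift \<phi> u"
proof -
  show "uea_lift \<phi> (uea_of x) = \<phi> x"
    using uea_lift_abs[OF assms] by (simp add: uea_of.abs_eq free_ev_letter)
  show "uea_lift \<phi> 1 = 1"
    using uea_lift_abs[OF assms] by (simp add: one_uea.abs_eq free_ev_one)
  show "uea_lift \<phi> (u + v) = uea_lift \<phi> u + uea_lift \<phi> v"
    by (induct u rule: uea.abs_induct, induct v rule: uea.abs_induct)
      (simp add: plus_uea.abs_eq uea_lift_abs[OF assms] free_ev_def lin_ext_add)
  show "uea_lift \<phi> (u * v) = uea_lift \<phi> u * uea_lift \<phi> v"
    by (induct u rule: uea.abs_induct, induct v rule: uea.abs_induct)
      (simp add: times_uea.abs_eq uea_lift_abs[OF assms] free_ev_mult)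
  show "uea_lift \<phi> (c *\<^sub>c u) = c *\<^sub>c uea_lift \<phi> u"
    by (induct u rule: uea.abs_induct)
      (simp add: cscale_uea.abs_eq uea_lift_abs[OF assms] free_ev_def lin_ext_cscale)
qed

lemma assoc_lie_hom_uea_of: "assoc_lie_hom (uea_of :: 'g::lie_algebra \<Rightarrow> 'g uea)"
proof -
  have "uea_of (x + y) = uea_of x + uea_of y" for x y :: 'g
  proof transfer
    fix x y :: 'g
    have "letter (x + y) - letter x - letter y \<in> ideal_hull uea_relations"
      by (rule ideal_hull.base) (auto simp: uea_relations_def)
    then show "uea_eq (letter (x + y)) (letter x + letter y)"
      by (simp add: uea_eq_def diff_diff_eq)
  qed
  moreover have "uea_of (c *\<^sub>c x) = c *\<^sub>c uea_of x" for x :: 'g and c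
  proof transfer
    fix x :: 'g and c
    show "uea_eq (letter (c *\<^sub>c x)) (c *\<^sub>c letter x)"
      unfolding uea_eq_def by (rule ideal_hull.base) (auto simp: uea_relations_def)
  qed
  moreover have "uea_of (bracket x y) = uea_of x * uea_of y - uea_of y * uea_of x" for x y :: 'g
  proof transfer
    fix x y :: 'g
    have "letter x * letter y - letter y * letter x - letter (bracket x y) \<in> ideal_hull uea_relations"
      by (rule ideal_hull.base) (auto simp: uea_relations_def)
    from ideal_hull_uminus[OF this]
    show "uea_eq (letter (bracket x y)) (letter x * letter y - letter y * letter x)"
      by (simp add: uea_eq_def)
  qed
  ultimately show ?thesis
    unfolding assoc_lie_hom_def Vector_Spaces.linear_iff
    by (auto intro: cvec.vector_space_axioms)
qed

lemma uea_induct [case_names scalar gen add mult]: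
  assumes s: "\<And>c. P (c *\<^sub>c 1)" and g: "\<And>x. P (uea_of x)"
    and a: "\<And>u v. P u \<Longrightarrow> P v \<Longrightarrow> P (u + v)" and m: "\<And>u v. P u \<Longrightarrow> P v \<Longrightarrow> P (u * v)"
  shows "P (u :: 'g::lie_algebra uea)"
proof -
  have word: "P (abs_uea (Poly_Mapping.single (FMon xs) 1))" for xs :: "'g list"
  proof (induction xs)
    case Nil
    have "abs_uea (Poly_Mapping.single (FMon []) 1) = (1 *\<^sub>c 1 :: 'g uea)"
      by (simp add: cscale_one one_uea.abs_eq single_one[symmetric] zero_fmon_def)
    then show ?case using s by metis
  next
    case (Cons x xs)
    have "Poly_Mapping.single (FMon (x # xs)) 1 = letter x * Poly_Mapping.single (FMon xs) (1::complex)"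
      by (simp add: letter_def mult_single plus_fmon_def)
    then show ?case
      using m[OF g Cons.IH] by (simp add: uea_of.abs_eq times_uea.abs_eq)
  qed
  have "P (abs_uea p)" for p
  proof (induction p rule: basis_induct)
    case (single c k)
    have "abs_uea (c *\<^sub>c Poly_Mapping.single k 1) = (c *\<^sub>c 1) * abs_uea (Poly_Mapping.single k 1)"
      by (simp add: cscale_mult_left cscale_uea.abs_eq)
    then show ?case using m[OF s word[of "letters k"]] by simp
  next
    case (add p q)
    then show ?case using a by (simp add: plus_uea.abs_eq[symmetric])
  qed
  then show ?thesis by (induct u rule: uea.abs_induct)
qed

lemma uea_of_bracket: "uea_of (bracket x y) = uea_of x * uea_of y - uea_of y * uea_of x"
  using assoc_lie_hom_uea_of unfolding assoc_lie_hom_def by blast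

text \<open>The (unital) subalgebra generated by a set.\<close>

inductive_set subalgebra_gen :: "'a::complex_alg set \<Rightarrow> 'a set" for S where
  scalar: "c *\<^sub>c 1 \<in> subalgebra_gen S"
| base: "a \<in> S \<Longrightarrow> a \<in> subalgebra_gen S"
| add: "a \<in> subalgebra_gen S \<Longrightarrow> b \<in> subalgebra_gen S \<Longrightarrow> a + b \<in> subalgebra_gen S"
| mult: "a \<in> subalgebra_gen S \<Longrightarrow> b \<in> subalgebra_gen S \<Longrightarrow> a * b \<in> subalgebra_gen S"

section \<open>Left modules, quotients and extension of scalars\<close>

record ('r, 'm) lmod =
  mcarrier :: "'m set"
  mzero :: 'm
  madd :: "'m \<Rightarrow> 'm \<Rightarrow> 'm"
  mact :: "'r \<Rightarrow> 'm \<Rightarrow> 'm"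

text \<open>An abelian group on which a monoid acts by group endomorphisms.\<close>

definition acted_group :: "('r::monoid_mult, 'm) lmod \<Rightarrow> bool" where
  "acted_group V \<longleftrightarrow>
     mzero V \<in> mcarrier V \<and>
     (\<forall>x\<in>mcarrier V. \<forall>y\<in>mcarrier V. madd V x y \<in> mcarrier V) \<and>
     (\<forall>x\<in>mcarrier V. \<forall>y\<in>mcarrier V. \<forall>z\<in>mcarrier V. madd V (madd V x y) z = madd V x (madd V y z)) \<and>
     (\<forall>x\<in>mcarrier V. \<forall>y\<in>mcarrier V. madd V x y = madd V y x) \<and>
     (\<forall>x\<in>mcarrier V. madd V (mzero V) x = x) \<and>
     (\<forall>x\<in>mcarrier V. \<exists>y\<in>mcarrier V. madd V x y = mzero V) \<and>
     (\<forall>r. \<forall>x\<in>mcarrier V. mact V r x \<in> mcarrier V) \<and>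
     (\<forall>r. \<forall>x\<in>mcarrier V. \<forall>y\<in>mcarrier V. mact V r (madd V x y) = madd V (mact V r x) (mact V r y)) \<and>
     (\<forall>r s. \<forall>x\<in>mcarrier V. mact V (r * s) x = mact V r (mact V s x)) \<and>
     (\<forall>x\<in>mcarrier V. mact V 1 x = x)"

definition left_module :: "('r::ring_1, 'm) lmod \<Rightarrow> bool" where
  "left_module V \<longleftrightarrow> acted_group V \<and>
     (\<forall>r s. \<forall>x\<in>mcarrier V. mact V (r + s) x = madd V (mact V r x) (mact V s x))"

definition submodule :: "'m set \<Rightarrow> ('r, 'm) lmod \<Rightarrow> bool" where
  "submodule N V \<longleftrightarrow> N \<subseteq> mcarrier V \<and> mzero V \<in> N \<and>
     (\<forall>x\<in>N. \<forall>y\<in>N. madd V x y \<in> N) \<and>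
     (\<forall>x\<in>N. \<exists>y\<in>N. madd V x y = mzero V) \<and>
     (\<forall>r. \<forall>x\<in>N. mact V r x \<in> N)"

definition mcoset :: "('r, 'm) lmod \<Rightarrow> 'm set \<Rightarrow> 'm \<Rightarrow> 'm set" where
  "mcoset V N x = {madd V x n | n. n \<in> N}"

definition quot_module :: "('r, 'm) lmod \<Rightarrow> 'm set \<Rightarrow> ('r, 'm set) lmod" where
  "quot_module V N =
     \<lparr>mcarrier = mcoset V N ` mcarrier V,
      mzero = mcoset V N (mzero V),
      madd = (\<lambda>X Y. \<Union>x\<in>X. \<Union>y\<in>Y. mcoset V N (madd V x y)),
      mact = (\<lambda>r X. \<Union>x\<in>X. mcoset V N (mact V r x))\<rparr>"

text \<open>For a ring homomorphism \<open>f :: 's \<Rightarrow> 'r\<close> and a left \<open>'s\<close>-module \<open>V\<close>, the tensor product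
  \<open>'r \<otimes>\<^bsub>'s\<^esub> V\<close>, where \<open>'r\<close> is a right \<open>'s\<close>-module through \<open>f\<close>: the free abelian group on the pairs
  \<open>(u, a)\<close>, with \<open>'r\<close> acting by left multiplication on the first component, modulo biadditivity and
  \<open>u f(s) \<otimes> a = u \<otimes> s a\<close>.  The action is additive in the ring element only after passing to the
  quotient.\<close>

definition pair_group :: "('s, 'm) lmod \<Rightarrow> ('r::ring_1, ('r \<times> 'm) \<Rightarrow>\<^sub>0 int) lmod" where
  "pair_group V =
     \<lparr>mcarrier = {p. Poly_Mapping.keys p \<subseteq> UNIV \<times> mcarrier V},
      mzero = 0,
      madd = (+),
      mact = (\<lambda>r. frag_extend (\<lambda>(u, a). frag_of (r * u, a)))\<rparr>"

definition tensor_relations ::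
    "('s \<Rightarrow> 'r) \<Rightarrow> ('s, 'm) lmod \<Rightarrow> (('r::ring_1 \<times> 'm) \<Rightarrow>\<^sub>0 int) set" where
  "tensor_relations f V = group_closure
     ({frag_of (u + v, a) - frag_of (u, a) - frag_of (v, a) | u v a. a \<in> mcarrier V} \<union>
      {frag_of (u, madd V a b) - frag_of (u, a) - frag_of (u, b) | u a b.
         a \<in> mcarrier V \<and> b \<in> mcarrier V} \<union>
      {frag_of (u * f s, a) - frag_of (u, mact V s a) | u s a. a \<in> mcarrier V})"

definition ext_scalars ::
    "('s \<Rightarrow> 'r) \<Rightarrow> ('s, 'm) lmod \<Rightarrow> ('r::ring_1, (('r \<times> 'm) \<Rightarrow>\<^sub>0 int) set) lmod" where
  "ext_scalars f V = quot_module (pair_group V) (tensor_relations f V)"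

definition pure_tensor ::
    "('s \<Rightarrow> 'r) \<Rightarrow> ('s, 'm) lmod \<Rightarrow> 'r::ring_1 \<Rightarrow> 'm \<Rightarrow> (('r \<times> 'm) \<Rightarrow>\<^sub>0 int) set" where
  "pure_tensor f V u a = mcoset (pair_group V :: ('r, _) lmod) (tensor_relations f V) (frag_of (u, a))"

lemma acted_groupD:
  assumes "acted_group V"
  shows "mzero V \<in> mcarrier V"
    and "\<And>x y. x \<in> mcarrier V \<Longrightarrow> y \<in> mcarrier V \<Longrightarrow> madd V x y \<in> mcarrier V"
    and "\<And>x y z. x \<in> mcarrier V \<Longrightarrow> y \<in> mcarrier V \<Longrightarrow> z \<in> mcarrier V \<Longrightarrow>
          madd V (madd V x y) z = madd V x (madd V y z)"
    and "\<And>x y. x \<in> mcarrier V \<Longrightarrow> y \<in> mcarrier V \<Longrightarrow> madd V x y = madd V y x"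
    and "\<And>x. x \<in> mcarrier V \<Longrightarrow> madd V (mzero V) x = x"
    and "\<And>x. x \<in> mcarrier V \<Longrightarrow> \<exists>y\<in>mcarrier V. madd V x y = mzero V"
    and "\<And>x r. x \<in> mcarrier V \<Longrightarrow> mact V r x \<in> mcarrier V"
    and "\<And>x y r. x \<in> mcarrier V \<Longrightarrow> y \<in> mcarrier V \<Longrightarrow>
          mact V r (madd V x y) = madd V (mact V r x) (mact V r y)"
    and "\<And>x r s. x \<in> mcarrier V \<Longrightarrow> mact V (r * s) x = mact V r (mact V s x)"
    and "\<And>x. x \<in> mcarrier V \<Longrightarrow> mact V 1 x = x"
proof -
  note A = assms[unfolded acted_group_def]
  show "mzero V \<in> mcarrier V"
    by (rule A[THEN conjunct1])
  show "\<And>x y. x \<in> mcarrier V \<Longrightarrow> y \<in> mcarrier V \<Longrightarrow> madd V x y \<in> mcarrier V"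
    by (rule A[THEN conjunct2, THEN conjunct1, rule_format])
  show "\<And>x y z. x \<in> mcarrier V \<Longrightarrow> y \<in> mcarrier V \<Longrightarrow> z \<in> mcarrier V \<Longrightarrow>
          madd V (madd V x y) z = madd V x (madd V y z)"
    by (rule A[THEN conjunct2, THEN conjunct2, THEN conjunct1, rule_format])
  show "\<And>x y. x \<in> mcarrier V \<Longrightarrow> y \<in> mcarrier V \<Longrightarrow> madd V x y = madd V y x"
    by (rule A[THEN conjunct2, THEN conjunct2, THEN conjunct2, THEN conjunct1, rule_format])
  show "\<And>x. x \<in> mcarrier V \<Longrightarrow> madd V (mzero V) x = x"
    by (rule A[THEN conjunct2, THEN conjunct2, THEN conjunct2, THEN conjunct2, THEN conjunct1, rule_format])
  show "\<And>x. x \<in> mcarrier V \<Longrightarrow> \<exists>y\<in>mcarrier V. madd V x y = mzero V"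
    by (rule A[THEN conjunct2, THEN conjunct2, THEN conjunct2, THEN conjunct2, THEN conjunct2, THEN conjunct1, rule_format])
  show "\<And>x r. x \<in> mcarrier V \<Longrightarrow> mact V r x \<in> mcarrier V"
    by (rule A[THEN conjunct2, THEN conjunct2, THEN conjunct2, THEN conjunct2, THEN conjunct2, THEN conjunct2, THEN conjunct1, rule_format])
  show "\<And>x y r. x \<in> mcarrier V \<Longrightarrow> y \<in> mcarrier V \<Longrightarrow>
          mact V r (madd V x y) = madd V (mact V r x) (mact V r y)"
    by (rule A[THEN conjunct2, THEN conjunct2, THEN conjunct2, THEN conjunct2, THEN conjunct2, THEN conjunct2, THEN conjunct2, THEN conjunct1, rule_format])
  show "\<And>x r s. x \<in> mcarrier V \<Longrightarrow> mact V (r * s) x = mact V r (mact V s x)"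
    by (rule A[THEN conjunct2, THEN conjunct2, THEN conjunct2, THEN conjunct2, THEN conjunct2, THEN conjunct2, THEN conjunct2, THEN conjunct2, THEN conjunct1, rule_format])
  show "\<And>x. x \<in> mcarrier V \<Longrightarrow> mact V 1 x = x"
    by (rule A[THEN conjunct2, THEN conjunct2, THEN conjunct2, THEN conjunct2, THEN conjunct2, THEN conjunct2, THEN conjunct2, THEN conjunct2, THEN conjunct2, rule_format])
qed

lemma submoduleD:
  assumes "submodule N V"
  shows "\<And>x. x \<in> N \<Longrightarrow> x \<in> mcarrier V" and "mzero V \<in> N"
    and "\<And>x y. x \<in> N \<Longrightarrow> y \<in> N \<Longrightarrow> madd V x y \<in> N"
    and "\<And>x. x \<in> N \<Longrightarrow> \<exists>y\<in>N. madd V x y = mzero V"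
    and "\<And>r x. x \<in> N \<Longrightarrow> mact V r x \<in> N"
  using assms unfolding submodule_def by auto

lemma mcoset_eqI:
  assumes V: "acted_group V" and N: "submodule N V"
    and x: "x \<in> mcarrier V" and n: "n \<in> N"
  shows "mcoset V N (madd V x n) = mcoset V N x"
proof -
  note V' = acted_groupD[OF V] and N' = submoduleD[OF N]
  have 1: "mcoset V N (madd V x n) \<subseteq> mcoset V N x" if "x \<in> mcarrier V" "n \<in> N" for x n
    using that unfolding mcoset_def using V'(3) N'(1,3) by fastforce
  obtain m where m: "m \<in> N" "madd V n m = mzero V" using N'(4)[OF n] by blast
  have "madd V (madd V x n) m = x"
    using V'(3)[OF x N'(1)[OF n] N'(1)[OF m(1)]] m V'(4)[OF x V'(1)] V'(5)[OF x] by simp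
  then have "mcoset V N x \<subseteq> mcoset V N (madd V x n)"
    using 1[OF V'(2)[OF x N'(1)[OF n]] m(1)] by simp
  with 1[OF x n] show ?thesis by blast
qed

lemma mcosetE:
  assumes "y \<in> mcoset V N x" obtains n where "n \<in> N" "y = madd V x n"
  using assms unfolding mcoset_def by blast

lemma mcoset_self:
  assumes V: "acted_group V" and N: "submodule N V" and x: "x \<in> mcarrier V"
  shows "x \<in> mcoset V N x"
proof -
  have "x = madd V x (mzero V)" using acted_groupD(4)[OF V x acted_groupD(1)[OF V]] acted_groupD(5)[OF V x] by simp
  then show ?thesis unfolding mcoset_def using submoduleD(2)[OF N] by blast
qed

lemma madd_quot:
  assumes V: "acted_group V" and N: "submodule N V"
    and x: "x \<in> mcarrier V" and y: "y \<in> mcarrier V"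
  shows "madd (quot_module V N) (mcoset V N x) (mcoset V N y) = mcoset V N (madd V x y)"
proof -
  note V' = acted_groupD[OF V] and N' = submoduleD[OF N]
  have "mcoset V N (madd V x' y') = mcoset V N (madd V x y)"
    if x': "x' \<in> mcoset V N x" and y': "y' \<in> mcoset V N y" for x' y'
  proof -
    obtain n m where nm: "n \<in> N" "x' = madd V x n" "m \<in> N" "y' = madd V y m"
      using mcosetE[OF x'] mcosetE[OF y'] by metis
    have c: "n \<in> mcarrier V" "m \<in> mcarrier V" using nm N' by auto
    have "madd V x' y' = madd V x (madd V n (madd V y m))"
      using nm c V'(2,3) x y by simp
    also have "madd V n (madd V y m) = madd V (madd V n y) m"
      using c V'(3) y by simp
    also have "madd V n y = madd V y n" using c V'(4) y by simp
    also have "madd V (madd V y n) m = madd V y (madd V n m)"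
      using c V'(3) y by simp
    also have "madd V x (madd V y (madd V n m)) = madd V (madd V x y) (madd V n m)"
      using c V'(2,3) x y by simp
    finally show ?thesis
      using mcoset_eqI[OF V N V'(2)[OF x y] N'(3)[of n m]] nm by simp
  qed
  then have "(\<Union>x'\<in>mcoset V N x. \<Union>y'\<in>mcoset V N y. mcoset V N (madd V x' y')) =
    (\<Union>x'\<in>mcoset V N x. \<Union>y'\<in>mcoset V N y. mcoset V N (madd V x y))" by (intro SUP_cong refl) simp
  also have "\<dots> = mcoset V N (madd V x y)"
    using mcoset_self[OF V N x] mcoset_self[OF V N y] by blast
  finally show ?thesis unfolding quot_module_def by simp
qed

lemma mact_quot:
  assumes V: "acted_group V" and N: "submodule N V" and x: "x \<in> mcarrier V"
  shows "mact (quot_module V N) r (mcoset V N x) = mcoset V N (mact V r x)"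
proof -
  note V' = acted_groupD[OF V] and N' = submoduleD[OF N]
  have "mcoset V N (mact V r x') = mcoset V N (mact V r x)"
    if x': "x' \<in> mcoset V N x" for x'
  proof -
    obtain n where n: "n \<in> N" "x' = madd V x n" using mcosetE[OF x'] by metis
    have "mact V r x' = madd V (mact V r x) (mact V r n)" using n V'(8) N'(1) x by simp
    then show ?thesis using mcoset_eqI[OF V N V'(7)[OF x] N'(5)[OF n(1)]] by simp
  qed
  then have "(\<Union>x'\<in>mcoset V N x. mcoset V N (mact V r x')) =
    (\<Union>x'\<in>mcoset V N x. mcoset V N (mact V r x))" by (intro SUP_cong refl) simp
  also have "\<dots> = mcoset V N (mact V r x)"
    using mcoset_self[OF V N x] by blast
  finally show ?thesis unfolding quot_module_def by simp
qed

lemma quot_simps: "mcarrier (quot_module V N) = mcoset V N ` mcarrier V"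
  "mzero (quot_module V N) = mcoset V N (mzero V)"
  by (simp_all add: quot_module_def)

lemma acted_group_quot:
  assumes V: "acted_group V" and N: "submodule N V"
  shows "acted_group (quot_module V N)"
proof -
  note V' = acted_groupD[OF V] and q = madd_quot[OF V N] mact_quot[OF V N] quot_simps
  show ?thesis
    unfolding acted_group_def
  proof (intro conjI)
    show "\<forall>x\<in>mcarrier (quot_module V N). \<exists>y\<in>mcarrier (quot_module V N).
      madd (quot_module V N) x y = mzero (quot_module V N)"
    proof
      fix X assume "X \<in> mcarrier (quot_module V N)"
      then obtain x where x: "x \<in> mcarrier V" "X = mcoset V N x" by (auto simp: quot_simps)
      then obtain y where "y \<in> mcarrier V" "madd V x y = mzero V" using V'(6) by blast
      then show "\<exists>y\<in>mcarrier (quot_module V N).  madd (quot_module V N) X y = mzero (quot_module V N)"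
        by (intro bexI[of _ "mcoset V N y"]) (use x in \<open>simp_all add: q\<close>)
    qed
    show "\<forall>x\<in>mcarrier (quot_module V N). \<forall>y\<in>mcarrier (quot_module V N).
      madd (quot_module V N) x y = madd (quot_module V N) y x"
    proof (intro ballI)
      fix X Y assume "X \<in> mcarrier (quot_module V N)" "Y \<in> mcarrier (quot_module V N)"
      then obtain x y where x: "x \<in> mcarrier V" "X = mcoset V N x" "y \<in> mcarrier V" "Y = mcoset V N y"
        by (auto simp: quot_simps)
      then show "madd (quot_module V N) X Y = madd (quot_module V N) Y X"
        by (simp add: q(1) V'(4)[of x y])
    qed
  qed (simp_all add: q V'(1,2,3,5,7,8,9,10))
qed

lemma left_module_quotI:
  assumes V: "acted_group V" and N: "submodule N V"
    and d: "\<And>r s x. x \<in> mcarrier V \<Longrightarrow> mcoset V N (mact V (r + s) x) = mcoset V N (madd V (mact V r x) (mact V s x))"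
  shows "left_module (quot_module V N)"
  unfolding left_module_def
proof (intro conjI acted_group_quot[OF V N] allI ballI)
  fix r s X assume "X \<in> mcarrier (quot_module V N)"
  then obtain x where x: "x \<in> mcarrier V" "X = mcoset V N x" by (auto simp: quot_simps)
  show "mact (quot_module V N) (r + s) X = madd (quot_module V N) (mact (quot_module V N) r X) (mact (quot_module V N) s X)"
    by (simp add: x mact_quot[OF V N] d madd_quot[OF V N] acted_groupD(7)[OF V])
qed

lemma keys_pair_act:
  assumes "Poly_Mapping.keys p \<subseteq> UNIV \<times> A"
  shows "Poly_Mapping.keys (frag_extend (\<lambda>(u, a). frag_of (r * u, a)) p) \<subseteq> UNIV \<times> A"
proof
  fix z assume "z \<in> Poly_Mapping.keys (frag_extend (\<lambda>(u, a). frag_of (r * u, a)) p)"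
  then obtain y where "y \<in> Poly_Mapping.keys p" "z \<in> Poly_Mapping.keys ((\<lambda>(u, a). frag_of (r * u, a)) y)"
    using keys_frag_extend by fast
  then show "z \<in> UNIV \<times> A" using assms by (cases y) auto
qed

lemma acted_group_pair: fixes V :: "('s, 'b) lmod" shows "acted_group (pair_group V :: ('r::ring_1, _) lmod)"
proof -
  have ka: "Poly_Mapping.keys (x+y) \<subseteq> S" if "Poly_Mapping.keys x \<subseteq> S" "Poly_Mapping.keys y \<subseteq> S"
    for x y :: "('r \<times> 'b) \<Rightarrow>\<^sub>0 int" and S
    using that Poly_Mapping.keys_add[of x y] by blast
  have m: "frag_extend (\<lambda>(u, a). frag_of (r * s * u, a)) p =
    frag_extend (\<lambda>(u, a). frag_of (r * u, a)) (frag_extend (\<lambda>(u, a). frag_of (s * u, a)) p)"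
    for r s :: 'r and p :: "('r \<times> 'b) \<Rightarrow>\<^sub>0 int"
    using subset_UNIV[of "Poly_Mapping.keys p"] by (induction p rule: frag_induction)
      (auto simp: frag_extend_diff mult.assoc)
  have o: "frag_extend (\<lambda>(u, a). frag_of (1 * u, a)) p = p" for p :: "('r \<times> 'b) \<Rightarrow>\<^sub>0 int"
    using subset_UNIV[of "Poly_Mapping.keys p"] by (induction p rule: frag_induction)
      (auto simp: frag_extend_diff)
  have neg: "\<exists>y. x + y = 0 \<and> Poly_Mapping.keys y \<subseteq> S" if "Poly_Mapping.keys x \<subseteq> S" for x :: "('r \<times> 'b) \<Rightarrow>\<^sub>0 int" and S
    using that by (intro exI[of _ "-x"]) simp
  show ?thesis
    unfolding acted_group_def pair_group_def
    by (intro conjI ballI allI; (simp add: ka m[unfolded mult.assoc] o[simplified] keys_pair_act frag_extend_add ac_simps)?; (rule neg, simp)?)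
qed

lemma submodule_tensor_relations:
  fixes V :: "('s, 'b) lmod"
  assumes cl: "\<And>s x. x \<in> mcarrier V \<Longrightarrow> mact V s x \<in> mcarrier V"
    "\<And>x y. x \<in> mcarrier V \<Longrightarrow> y \<in> mcarrier V \<Longrightarrow> madd V x y \<in> mcarrier V"
  shows "submodule (tensor_relations f V) (pair_group V :: ('r::ring_1, _) lmod)"
proof -
  let ?T = "tensor_relations f V :: (('r \<times> 'b) \<Rightarrow>\<^sub>0 int) set"
  let ?m = "\<lambda>r. frag_extend (\<lambda>(u, a). frag_of (r * u, a)) :: (('r \<times> 'b) \<Rightarrow>\<^sub>0 int) \<Rightarrow> _"
  have kd: "Poly_Mapping.keys (x-y) \<subseteq> S" if "Poly_Mapping.keys x \<subseteq> S" "Poly_Mapping.keys y \<subseteq> S"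
    for x y :: "('r \<times> 'b) \<Rightarrow>\<^sub>0 int" and S
    using that Poly_Mapping.keys_diff[of x y] by blast
  have k: "Poly_Mapping.keys p \<subseteq> UNIV \<times> mcarrier V" if "p \<in> ?T" for p
    using that unfolding tensor_relations_def
  proof induction
    case (base s)
    then show ?case
      by (elim insertE UnE CollectE exE conjE; hypsubst; (intro kd)?; simp add: cl)
  qed (rule kd)
  have a: "?m r p \<in> ?T" if "p \<in> ?T" for r p
    using that unfolding tensor_relations_def
  proof induction
    case (base s)
    then show ?case
    proof (elim insertE UnE, goal_cases)
      case 1 then show ?case by simp
    next
      case 2
      then obtain u v a where "s = frag_of (u + v, a) - frag_of (u, a) - frag_of (v, a)" "a \<in> mcarrier V" by blast
      then have "?m r s = frag_of (r * u + r * v, a) - frag_of (r * u, a) - frag_of (r * v, a)" "a \<in> mcarrier V"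
        by (simp_all add: frag_extend_diff distrib_left)
      then show ?case
        by (intro group_closure.base insertI2 UnI1) blast
    next
      case 3
      then obtain u a b where "s = frag_of (u, madd V a b) - frag_of (u, a) - frag_of (u, b)" "a \<in> mcarrier V \<and> b \<in> mcarrier V" by blast
      then have "?m r s = frag_of (r * u, madd V a b) - frag_of (r * u, a) - frag_of (r * u, b)" "a \<in> mcarrier V \<and> b \<in> mcarrier V"
        by (simp_all add: frag_extend_diff)
      then have "?m r s \<in> {frag_of (u, madd V a b) - frag_of (u, a) - frag_of (u, b) |u a b.
         a \<in> mcarrier V \<and> b \<in> mcarrier V}" by blast
      then show ?case
        by (intro group_closure.base) simp
    next
      case 4
      then obtain u q a where "s = frag_of (u * f q, a) - frag_of (u, mact V q a)" "a \<in> mcarrier V" by blast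
      then have "?m r s = frag_of ((r * u) * f q, a) - frag_of (r * u, mact V q a)" "a \<in> mcarrier V"
        by (auto simp: frag_extend_diff mult.assoc)
      then show ?case
        by (intro group_closure.base insertI2 UnI2) blast
    qed
  next
    case (diff s t)
    then show ?case by (auto simp: frag_extend_diff intro: group_closure.diff)
  qed
  show ?thesis
    unfolding submodule_def pair_group_def
  proof (intro conjI ballI allI subsetI, goal_cases)
    case (4 x)
    then show ?case by (intro bexI[of _ "- x"]) (simp_all add: tensor_relations_def)
  next
    case (1 x) then show ?case using k by simp
  next
    case 2 then show ?case by (simp add: tensor_relations_def)
  next
    case 3 then show ?case by (simp add: tensor_relations_def group_closure_add)
  next
    case 5 then show ?case using a by simp
  qed
qed

lemma left_module_ext_scalars:
  fixes V :: "('s, 'b) lmod"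
  assumes cl: "\<And>s x. x \<in> mcarrier V \<Longrightarrow> mact V s x \<in> mcarrier V"
    "\<And>x y. x \<in> mcarrier V \<Longrightarrow> y \<in> mcarrier V \<Longrightarrow> madd V x y \<in> mcarrier V"
  shows "left_module (ext_scalars f V :: ('r::ring_1, _) lmod)"
  unfolding ext_scalars_def
proof (rule left_module_quotI[OF acted_group_pair submodule_tensor_relations[OF cl]])
  fix r s :: 'r and p assume p: "p \<in> mcarrier (pair_group V :: ('r, _) lmod)"
  let ?P = "pair_group V :: ('r, _) lmod"
  let ?T = "tensor_relations f V :: (('r \<times> 'b) \<Rightarrow>\<^sub>0 int) set"
  have "Poly_Mapping.keys p \<subseteq> UNIV \<times> mcarrier V" using p by (simp add: pair_group_def)
  then have "mact ?P (r + s) p - (mact ?P r p + mact ?P s p) \<in> ?T"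
  proof (induction p rule: frag_induction)
    case (one x)
    then show ?case
      by (auto simp: pair_group_def tensor_relations_def distrib_right diff_diff_eq[symmetric] intro!: group_closure.base)
  next
    case (diff a b)
    have "mact ?P (r + s) (a - b) - (mact ?P r (a - b) + mact ?P s (a - b)) =
      (mact ?P (r + s) a - (mact ?P r a + mact ?P s a)) - (mact ?P (r + s) b - (mact ?P r b + mact ?P s b))"
      by (simp add: pair_group_def frag_extend_diff)
    then show ?case using diff by (auto simp: tensor_relations_def intro: group_closure.diff)
  qed (simp add: pair_group_def tensor_relations_def)
  moreover have "mact ?P r p + mact ?P s p \<in> mcarrier ?P"
    using acted_groupD(2)[OF acted_group_pair acted_groupD(7)[OF acted_group_pair p, of r] acted_groupD(7)[OF acted_group_pair p, of s]]
    by (simp add: pair_group_def)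
  ultimately have "mcoset ?P ?T (madd ?P (mact ?P r p + mact ?P s p) (mact ?P (r + s) p - (mact ?P r p + mact ?P s p)))
     = mcoset ?P ?T (mact ?P r p + mact ?P s p)"
    using mcoset_eqI[OF acted_group_pair submodule_tensor_relations[OF cl]] by blast
  then show "mcoset ?P ?T (mact ?P (r + s) p) = mcoset ?P ?T (madd ?P (mact ?P r p) (mact ?P s p))"
    by (simp add: pair_group_def)
qed

lemma left_module_quot:
  assumes V: "left_module V" and N: "submodule N V"
  shows "left_module (quot_module V N)"
  using left_module_quotI[OF _ N] V unfolding left_module_def by simp

lemma submodule_central:
  assumes V: "left_module V" and c: "\<And>u. c * u = u * c"
  shows "submodule (mact V c ` mcarrier V) V"
proof -
  have A: "acted_group V" using V by (simp add: left_module_def)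
  note A' = acted_groupD[OF A]
  have z: "mact V c (mzero V) = mzero V"
  proof -
    let ?z = "mact V c (mzero V)"
    have zc: "?z \<in> mcarrier V" using A'(1,7) by simp
    have "madd V ?z ?z = ?z" using A'(8)[OF A'(1) A'(1), of c] A'(5)[OF A'(1)] by simp
    moreover obtain y where y: "y \<in> mcarrier V" "madd V ?z y = mzero V" using A'(6)[OF zc] by blast
    ultimately have "mzero V = madd V ?z (mzero V)" using A'(3)[OF zc zc y(1)] by simp
    then show ?thesis using A'(4)[OF zc A'(1)] A'(5)[OF zc] by simp
  qed
  show ?thesis
    unfolding submodule_def
  proof (intro conjI ballI allI subsetI)
    fix x assume "x \<in> mact V c ` mcarrier V"
    then show "x \<in> mcarrier V" using A'(7) by auto
  next
    show "mzero V \<in> mact V c ` mcarrier V" using z A'(1) by (intro image_eqI) auto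
  next
    fix x y assume "x \<in> mact V c ` mcarrier V" "y \<in> mact V c ` mcarrier V"
    then obtain a b where "a \<in> mcarrier V" "b \<in> mcarrier V" "x = mact V c a" "y = mact V c b" by auto
    then show "madd V x y \<in> mact V c ` mcarrier V"
      by (intro image_eqI[of _ _ "madd V a b"]) (simp_all add: A'(2,8))
  next
    fix x assume "x \<in> mact V c ` mcarrier V"
    then obtain a where a: "a \<in> mcarrier V" "x = mact V c a" by auto
    obtain b where b: "b \<in> mcarrier V" "madd V a b = mzero V" using A'(6)[OF a(1)] by blast
    show "\<exists>y\<in>mact V c ` mcarrier V. madd V x y = mzero V"
      by (intro bexI[of _ "mact V c b"]) (use a b z in \<open>simp_all add: A'(8)[symmetric]\<close>)
  next
    fix r x assume "x \<in> mact V c ` mcarrier V"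
    then obtain a where a: "a \<in> mcarrier V" "x = mact V c a" by auto
    then have "mact V r x = mact V c (mact V r a)" using A'(9)[OF a(1)] c by metis
    then show "mact V r x \<in> mact V c ` mcarrier V" using a A'(7) by simp
  qed
qed

section \<open>The Schroedinger-Virasoro algebra\<close>

text \<open>The index \<open>IY n\<close> stands for the basis vector \<open>Y\<^bsub>n+1/2\<^esub>\<close>.\<close>

datatype sv_index = IL int | IM int | IY int

fun sv_basis_bracket :: "sv_index \<Rightarrow> sv_index \<Rightarrow> (sv_index \<Rightarrow>\<^sub>0 complex)" where
  "sv_basis_bracket (IL m) (IL n) = Poly_Mapping.single (IL (m + n)) (of_int n - of_int m)"
| "sv_basis_bracket (IL m) (IM n) = Poly_Mapping.single (IM (m + n)) (of_int n)"
| "sv_basis_bracket (IM m) (IL n) = - Poly_Mapping.single (IM (n + m)) (of_int m)"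
| "sv_basis_bracket (IL m) (IY n) =
     Poly_Mapping.single (IY (m + n)) (of_int n + (1 - of_int m) / 2)"
| "sv_basis_bracket (IY m) (IL n) =
     - Poly_Mapping.single (IY (n + m)) (of_int m + (1 - of_int n) / 2)"
| "sv_basis_bracket (IY m) (IY n) =
     Poly_Mapping.single (IM (m + n + 1)) (of_int n - of_int m)"
| "sv_basis_bracket (IM m) (IM n) = 0"
| "sv_basis_bracket (IM m) (IY n) = 0"
| "sv_basis_bracket (IY m) (IM n) = 0"

definition sv_bracket ::
    "(sv_index \<Rightarrow>\<^sub>0 complex) \<Rightarrow> (sv_index \<Rightarrow>\<^sub>0 complex) \<Rightarrow> (sv_index \<Rightarrow>\<^sub>0 complex)" where
  "sv_bracket x y = lin_ext (\<lambda>i. lin_ext (\<lambda>j. sv_basis_bracket i j) y) x"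

lemma sv_bracket_add_left: "sv_bracket (x + y) z = sv_bracket x z + sv_bracket y z"
  by (simp add: sv_bracket_def lin_ext_add)

lemma sv_bracket_add_right: "sv_bracket x (y + z) = sv_bracket x y + sv_bracket x z"
  by (simp add: sv_bracket_def lin_ext_add lin_ext_add_fun)

lemma sv_bracket_cscale_left: "sv_bracket (c *\<^sub>c x) y = c *\<^sub>c sv_bracket x y"
  by (simp add: sv_bracket_def lin_ext_cscale)

lemma sv_bracket_cscale_right: "sv_bracket x (c *\<^sub>c y) = c *\<^sub>c sv_bracket x y"
  by (simp add: sv_bracket_def lin_ext_cscale lin_ext_cscale_fun)

lemma sv_bracket_single:
  "sv_bracket (Poly_Mapping.single i c) (Poly_Mapping.single j d) =
     c *\<^sub>c d *\<^sub>c sv_basis_bracket i j"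
  by (simp add: sv_bracket_def)

lemmas sv_bracket_bilinear = sv_bracket_add_left sv_bracket_add_right
  sv_bracket_cscale_left sv_bracket_cscale_right

lemma cscale_single: "c *\<^sub>c Poly_Mapping.single i (d::complex) = Poly_Mapping.single i (c * d)"
  by (rule poly_mapping_eqI) (simp add: lookup_single cscale_complex_def when_def)

lemma sv_bracket_skew: "sv_bracket x y = - sv_bracket y x"
proof (induction x rule: basis_induct)
  case (single c i)
  show ?case
  proof (induction y rule: basis_induct)
    case (single d j)
    have "sv_basis_bracket i j = - sv_basis_bracket j i"
      by (cases i; cases j) (simp_all add: ac_simps single_uminus[symmetric])
    then show ?case
      by (simp add: sv_bracket_bilinear sv_bracket_single cscale_one cscale_cscale
          cvec.scale_minus_right mult.commute)
  next
    case (add p q)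
    then show ?case by (simp only: sv_bracket_add_left sv_bracket_add_right minus_add_distrib)
  qed
next
  case (add p q)
  then show ?case by (simp only: sv_bracket_add_left sv_bracket_add_right minus_add_distrib)
qed

lemma sv_bracket_self: "sv_bracket x x = 0"
proof (rule poly_mapping_eqI)
  fix k
  have "Poly_Mapping.lookup (sv_bracket x x) k = - Poly_Mapping.lookup (sv_bracket x x) k"
    by (metis lookup_uminus sv_bracket_skew)
  then show "Poly_Mapping.lookup (sv_bracket x x) k = Poly_Mapping.lookup 0 k"
    by (simp add: complex_eq_iff)
qed

lemma sv_bracket_uminus:
  "sv_bracket (- x) y = - sv_bracket x y" "sv_bracket x (- y) = - sv_bracket x y"
  using sv_bracket_cscale_left[of "- 1" x y] sv_bracket_cscale_right[of x "- 1" y]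
  by (simp_all add: cvec.scale_minus_left cscale_one)

lemma add_zero3:
  fixes a :: "'a::ab_group_add"
  assumes "a + b + c = 0" "a' + b' + c' = 0"
  shows "(a + a') + (b + b') + (c + c') = 0"
proof -
  have "(a + a') + (b + b') + (c + c') = (a + b + c) + (a' + b' + c')"
    by (simp only: ac_simps)
  then show ?thesis using assms by simp
qed

lemma sv_bracket_zero: "sv_bracket x 0 = 0"
  using sv_bracket_cscale_right[of x 0 0] by simp

lemma sv_bracket_jacobi:
  "sv_bracket x (sv_bracket y z) + sv_bracket y (sv_bracket z x) + sv_bracket z (sv_bracket x y) = 0"
proof (induction x rule: basis_induct)
  case (single c i)
  show ?case
  proof (induction y rule: basis_induct)
    case (single d j)
    show ?case
    proof (induction z rule: basis_induct)
      case (single e k)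
      let ?s = "\<lambda>i. Poly_Mapping.single i (1::complex)"
      have "sv_bracket (?s i) (sv_bracket (?s j) (?s k)) + sv_bracket (?s j) (sv_bracket (?s k) (?s i))
          + sv_bracket (?s k) (sv_bracket (?s i) (?s j)) = 0"
        by (cases i; cases j; cases k;
            simp add: sv_bracket_single cscale_one sv_bracket_uminus cscale_single
              cvec.scale_minus_right cvec.scale_minus_left sv_bracket_zero add.assoc add.commute
              add.left_commute;
            (rule poly_mapping_eqI;
              simp add: lookup_add lookup_minus lookup_single when_def
                add_divide_distrib diff_divide_distrib algebra_simps)?)
      then have "(c * d * e) *\<^sub>c (sv_bracket (?s i) (sv_bracket (?s j) (?s k))
          + sv_bracket (?s j) (sv_bracket (?s k) (?s i))
          + sv_bracket (?s k) (sv_bracket (?s i) (?s j))) = 0"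
        by (simp add: cvec.scale_zero_right)
      then show ?case
        by (simp only: sv_bracket_bilinear cscale_add_right cscale_cscale mult.commute
            mult.left_commute mult.assoc)
    next
      case (add p q)
      show ?case using add_zero3[OF add] by (simp only: sv_bracket_bilinear cscale_add_right)
    qed
  next
    case (add p q)
    show ?case using add_zero3[OF add] by (simp only: sv_bracket_bilinear cscale_add_right)
  qed
next
  case (add p q)
  show ?case using add_zero3[OF add] by (simp only: sv_bracket_bilinear cscale_add_right)
qed

typedef sv = "UNIV :: (sv_index \<Rightarrow>\<^sub>0 complex) set"
  morphisms sv_coeffs sv_of_coeffs
  by simp

setup_lifting type_definition_sv

instantiation sv :: lie_algebra
begin

lift_definition zero_sv :: sv is 0 .
lift_definition plus_sv :: "sv \<Rightarrow> sv \<Rightarrow> sv" is "(+)" .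
lift_definition minus_sv :: "sv \<Rightarrow> sv \<Rightarrow> sv" is "(-)" .
lift_definition uminus_sv :: "sv \<Rightarrow> sv" is uminus .
lift_definition cscale_sv :: "complex \<Rightarrow> sv \<Rightarrow> sv" is cscale .
lift_definition bracket_sv :: "sv \<Rightarrow> sv \<Rightarrow> sv" is sv_bracket .

instance
  by standard
    (simp_all only: sv_coeffs_inject[symmetric] zero_sv.rep_eq plus_sv.rep_eq minus_sv.rep_eq
      uminus_sv.rep_eq cscale_sv.rep_eq bracket_sv.rep_eq
      cscale_add_right cscale_add_left cscale_cscale cscale_one sv_bracket_bilinear
      sv_bracket_self sv_bracket_jacobi[unfolded add.assoc] ac_simps add_0_left right_minus diff_conv_add_uminus)

end

lift_definition sv_L :: "int \<Rightarrow> sv" is "\<lambda>n. Poly_Mapping.single (IL n) 1" .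
lift_definition sv_M :: "int \<Rightarrow> sv" is "\<lambda>n. Poly_Mapping.single (IM n) 1" .

text \<open>\<open>sv_Y n\<close> is \<open>Y\<^bsub>n+1/2\<^esub>\<close>.\<close>

lift_definition sv_Y :: "int \<Rightarrow> sv" is "\<lambda>n. Poly_Mapping.single (IY n) 1" .

lemma sv_brackets:
  "bracket (sv_L m) (sv_L n) = (of_int n - of_int m) *\<^sub>c sv_L (m + n)"
  "bracket (sv_L m) (sv_M n) = of_int n *\<^sub>c sv_M (m + n)"
  "bracket (sv_L m) (sv_Y n) = (of_int n + (1 - of_int m) / 2) *\<^sub>c sv_Y (m + n)"
  "bracket (sv_Y m) (sv_Y n) = (of_int n - of_int m) *\<^sub>c sv_M (m + n + 1)"
  "bracket (sv_M m) (sv_M n) = 0"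
  "bracket (sv_M m) (sv_Y n) = 0"
  "bracket (sv_M m) (sv_L n) = - of_int m *\<^sub>c sv_M (n + m)"
  "bracket (sv_Y m) (sv_L n) = - (of_int m + (1 - of_int n) / 2) *\<^sub>c sv_Y (n + m)"
  "bracket (sv_Y m) (sv_M n) = 0"
  by (simp_all only: sv_coeffs_inject[symmetric] bracket_sv.rep_eq cscale_sv.rep_eq zero_sv.rep_eq
      sv_L.rep_eq sv_M.rep_eq sv_Y.rep_eq sv_bracket_single sv_basis_bracket.simps cscale_single
      cscale_one mult_1_right mult_1_left single_uminus uminus_sv.rep_eq cvec.scale_minus_left)

lemma M0_central_sv: "bracket (sv_M 0) x = 0"
proof -
  have "sv_bracket (Poly_Mapping.single (IM 0) 1) p = 0" for p
  proof (induction p rule: basis_induct)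
    case (single c k)
    show ?case by (cases k) (simp_all add: sv_bracket_bilinear sv_bracket_single)
  qed (simp add: sv_bracket_bilinear)
  then show ?thesis
    by (simp add: sv_coeffs_inject[symmetric] bracket_sv.rep_eq zero_sv.rep_eq sv_M.rep_eq)
qed

lemma M0_central: "uea_of (sv_M 0) * u = u * uea_of (sv_M 0)"
proof (induction u rule: uea_induct)
  case (scalar c)
  show ?case by (simp add: cscale_mult_left cscale_mult_right)
next
  case (gen x)
  have "uea_of (0 :: sv) = 0"
    using uea_of_bracket[of "0 :: sv" 0] by (simp add: bracket_self)
  then show ?case using uea_of_bracket[of "sv_M 0" x] by (simp add: M0_central_sv)
next
  case (add u v)
  then show ?case by (simp add: distrib_left distrib_right)
next
  case (mult u v)
  then show ?case by (metis mult.assoc)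
qed

definition sv_plus_basis :: "sv set" where
  "sv_plus_basis = {sv_L n | n. n \<ge> 1} \<union> {sv_M n | n. n \<ge> 1} \<union> {sv_Y m | m. m \<ge> 0}"

lemma sv_plus_closed:
  assumes "x \<in> cvec.span sv_plus_basis" "y \<in> cvec.span sv_plus_basis"
  shows "bracket x y \<in> cvec.span sv_plus_basis"
proof -
  have basis: "bracket a b \<in> cvec.span sv_plus_basis"
    if ab: "a \<in> sv_plus_basis" "b \<in> sv_plus_basis" for a b
  proof -
    have in_span: "n \<ge> 1 \<Longrightarrow> c *\<^sub>c sv_L n \<in> cvec.span sv_plus_basis"
      "n \<ge> 1 \<Longrightarrow> c *\<^sub>c sv_M n \<in> cvec.span sv_plus_basis"
      "n \<ge> 0 \<Longrightarrow> c *\<^sub>c sv_Y n \<in> cvec.span sv_plus_basis" for c n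
      by (intro cvec.span_scale cvec.span_base; auto simp: sv_plus_basis_def)+
    from ab obtain n m where
      "a = sv_L n \<and> n \<ge> 1 \<or> a = sv_M n \<and> n \<ge> 1 \<or> a = sv_Y n \<and> n \<ge> 0"
      "b = sv_L m \<and> m \<ge> 1 \<or> b = sv_M m \<and> m \<ge> 1 \<or> b = sv_Y m \<and> m \<ge> 0"
      unfolding sv_plus_basis_def by blast
    then show ?thesis
      by (elim disjE conjE) (simp_all only: sv_brackets cvec.span_zero, (rule in_span, simp)+)
  qed
  have ay: "bracket a y \<in> cvec.span sv_plus_basis" if a: "a \<in> sv_plus_basis" for a
    using assms(2)
  proof (induction rule: cvec.span_induct_alt)
    case base
    have "bracket a 0 = 0"
      using bracket_add_right[of a 0 0] by simp
    then show ?case by (simp add: cvec.span_zero)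
  next
    case (step c b z)
    then show ?case
      using basis[OF a] by (simp add: bracket_add_right bracket_cscale_right cvec.span_add cvec.span_scale)
  qed
  show ?thesis
    using assms(1)
  proof (induction rule: cvec.span_induct_alt)
    case base
    have "bracket 0 y = 0"
      using bracket_add_left[of 0 0 y] by simp
    then show ?case by (simp add: cvec.span_zero)
  next
    case (step c b z)
    then show ?case
      using ay by (simp add: bracket_add_left bracket_cscale_left cvec.span_add cvec.span_scale)
  qed
qed

typedef sv_plus = "cvec.span sv_plus_basis"
  morphisms sv_incl sv_plus_of
  using cvec.span_zero by blast

setup_lifting type_definition_sv_plus

instantiation sv_plus :: lie_algebra
begin

lift_definition zero_sv_plus :: sv_plus is 0 by (rule cvec.span_zero)
lift_definition plus_sv_plus :: "sv_plus \<Rightarrow> sv_plus \<Rightarrow> sv_plus" is "(+)" by (rule cvec.span_add)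
lift_definition minus_sv_plus :: "sv_plus \<Rightarrow> sv_plus \<Rightarrow> sv_plus" is "(-)" by (rule cvec.span_diff)
lift_definition uminus_sv_plus :: "sv_plus \<Rightarrow> sv_plus" is uminus by (rule cvec.span_neg)
lift_definition cscale_sv_plus :: "complex \<Rightarrow> sv_plus \<Rightarrow> sv_plus" is cscale by (rule cvec.span_scale)
lift_definition bracket_sv_plus :: "sv_plus \<Rightarrow> sv_plus \<Rightarrow> sv_plus" is bracket by (rule sv_plus_closed)

instance
  by standard
    (simp_all only: sv_incl_inject[symmetric] zero_sv_plus.rep_eq plus_sv_plus.rep_eq
      minus_sv_plus.rep_eq uminus_sv_plus.rep_eq cscale_sv_plus.rep_eq bracket_sv_plus.rep_eq
      cscale_add_right cscale_add_left cscale_cscale cscale_one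
      bracket_add_left bracket_add_right bracket_cscale_left bracket_cscale_right
      bracket_self bracket_jacobi[unfolded add.assoc] ac_simps add_0_left right_minus diff_conv_add_uminus)

end

text \<open>The inclusion of \<open>U(sv\<^sup>+)\<close> in \<open>U(sv)\<close>.\<close>

definition uea_incl :: "sv_plus uea \<Rightarrow> sv uea" where
  "uea_incl = uea_lift (\<lambda>x. uea_of (sv_incl x))"

section \<open>Whittaker modules\<close>

text \<open>\<open>\<psi> (sv_plus_of x)\<close> is meaningful only for \<open>x\<close> in \<open>cvec.span sv_plus_basis\<close>.\<close>

definition C_psi :: "(sv_plus \<Rightarrow> complex) \<Rightarrow> (sv_plus uea, complex) lmod" where
  "C_psi \<psi> = \<lparr>mcarrier = UNIV, mzero = 0, madd = (+), mact = (\<lambda>r \<alpha>. uea_lift \<psi> r * \<alpha>)\<rparr>"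

type_synonym W_elem = "((sv uea \<times> complex) \<Rightarrow>\<^sub>0 int) set"

definition W_psi :: "(sv_plus \<Rightarrow> complex) \<Rightarrow> (sv uea, W_elem) lmod" where
  "W_psi \<psi> = ext_scalars uea_incl (C_psi \<psi>)"

definition central_sub :: "(sv_plus \<Rightarrow> complex) \<Rightarrow> complex \<Rightarrow> W_elem set" where
  "central_sub \<psi> \<xi> = mact (W_psi \<psi>) (uea_of (sv_M 0) - \<xi> *\<^sub>c 1) ` mcarrier (W_psi \<psi>)"

definition L_psi :: "(sv_plus \<Rightarrow> complex) \<Rightarrow> complex \<Rightarrow> (sv uea, W_elem set) lmod" where
  "L_psi \<psi> \<xi> = quot_module (W_psi \<psi>) (central_sub \<psi> \<xi>)"

lemma left_module_W_psi: "left_module (W_psi \<psi>)"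
  unfolding W_psi_def by (rule left_module_ext_scalars) (simp_all add: C_psi_def)

lemma submodule_central_sub: "submodule (central_sub \<psi> \<xi>) (W_psi \<psi>)"
  unfolding central_sub_def
  by (rule submodule_central[OF left_module_W_psi])
    (simp add: left_diff_distrib right_diff_distrib M0_central cscale_mult_left cscale_mult_right)

lemma left_module_L_psi: "left_module (L_psi \<psi> \<xi>)"
  unfolding L_psi_def by (rule left_module_quot[OF left_module_W_psi submodule_central_sub])

definition w_bar :: "(sv_plus \<Rightarrow> complex) \<Rightarrow> complex \<Rightarrow> W_elem set" where
  "w_bar \<psi> \<xi> = mcoset (W_psi \<psi>) (central_sub \<psi> \<xi>) (pure_tensor uea_incl (C_psi \<psi>) 1 1)"

text \<open>Scalars act through \<open>U(sv)\<close>; the zero vector counts as a Whittaker vector.\<close>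

definition whittaker_vector :: "(sv_plus \<Rightarrow> complex) \<Rightarrow> (sv uea, 'm) lmod \<Rightarrow> 'm \<Rightarrow> bool" where
  "whittaker_vector \<psi> V v \<longleftrightarrow> v \<in> mcarrier V \<and>
     (\<forall>x. mact V (uea_of (sv_incl x)) v = mact V (\<psi> x *\<^sub>c 1) v)"

definition whittaker_z :: "(sv_plus \<Rightarrow> complex) \<Rightarrow> complex \<Rightarrow> sv uea" where
  "whittaker_z \<psi> \<xi> =
    (let \<eta>1 = \<psi> (sv_plus_of (sv_L 1)); \<eta>2 = \<psi> (sv_plus_of (sv_L 2));
         \<eta>3 = \<psi> (sv_plus_of (sv_Y 0));
         L = (\<lambda>n. uea_of (sv_L n)); M = (\<lambda>n. uea_of (sv_M n)); Y = (\<lambda>n. uea_of (sv_Y n))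
     in if \<eta>1 = 0 \<and> \<eta>2 = 0 \<and> \<eta>3 = 0 then L 0
        else if \<eta>2 \<noteq> 0 \<or> \<eta>3 \<noteq> 0 then
          \<xi>\<^sup>2 *\<^sub>c L 0 - (\<xi> * \<eta>2) *\<^sub>c M (- 2) - (\<xi> * \<eta>1) *\<^sub>c M (- 1) + \<eta>2 *\<^sub>c (M (- 1))\<^sup>2
            - (\<xi> * \<eta>3 / 2) *\<^sub>c Y (- 1) + (\<eta>3\<^sup>2 / 2) *\<^sub>c M (- 1)
        else \<xi> *\<^sub>c L 0 - \<eta>1 *\<^sub>c M (- 1))"

end

theory Submission
  imports Defs
begin

text \<open>
  Let \<open>v\<close> be a Whittaker vector of a module on which \<open>M\<^sub>0\<close> acts by \<open>\<xi>\<close>. From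
  \<open>x z v = z x v + [x, z] v = \<psi>(x) z v + [x, z] v\<close> for \<open>x\<close> in \<open>sv\<^sup>+\<close>, the vector \<open>z v\<close> is again a
  Whittaker vector as soon as every commutator \<open>[x, z]\<close> kills \<open>v\<close>; by linearity this has to be
  checked only for basis vectors \<open>x\<close>. For each of the three shapes of \<open>z\<close> this is a computation
  (\<open>commutes_on_sv_plus_L0\<close>, \<open>commutes_on_sv_plus_z_L1\<close>, \<open>commutes_on_sv_plus_z_general\<close>). The summand
  of \<open>z\<close> in \<open>L\<^sub>0\<close> contributes multiples of \<open>\<psi>(x)\<close>. The summands in \<open>M\<^bsub>-2\<^esub>\<close>, \<open>M\<^bsub>-1\<^esub>\<close> and \<open>Y\<^bsub>-1/2\<^esub>\<close> cancel
  these at \<open>L\<^sub>2\<close>, \<open>L\<^sub>1\<close> and \<open>Y\<^bsub>1/2\<^esub>\<close>, the only basis vectors at which \<open>\<psi>\<close> can be nonzero, through the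
  central element \<open>M\<^sub>0\<close> that arises there. At \<open>L\<^sub>1\<close> the summands in \<open>M\<^bsub>-2\<^esub>\<close> and \<open>Y\<^bsub>-1/2\<^esub>\<close> leave further terms,
  which the summands \<open>\<eta>\<^sub>2 M\<^bsub>-1\<^esub>\<^sup>2\<close> and \<open>(\<eta>\<^sub>3\<^sup>2 / 2) M\<^bsub>-1\<^esub>\<close> remove.

  So \<open>z\<close> maps Whittaker vectors to Whittaker vectors, and then so does every polynomial in \<open>z\<close>, by
  induction over the generated subalgebra. It remains that the image of \<open>1 \<otimes> 1\<close> is a Whittaker vector,
  because \<open>x \<otimes> 1 = 1 \<otimes> \<psi>(x)\<close>, and that \<open>M\<^sub>0\<close> acts on the quotient by \<open>\<xi>\<close>.
\<close>

section \<open>Vectors of a module and the relations between their multiples\<close>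

locale module_vector =
  fixes V :: "('r::complex_alg, 'm) lmod" and v :: 'm
  assumes left_module: "left_module V"
    and carrier: "v \<in> mcarrier V"
begin

text \<open>
  Congruence modulo the annihilator of \<open>v\<close>, a left ideal. Computing with ring elements modulo this
  relation replaces computing in the module, whose addition is only a record field.
\<close>

definition agree :: "'r \<Rightarrow> 'r \<Rightarrow> bool"  (infix \<open>\<approx>\<close> 50) where
  "r \<approx> s \<longleftrightarrow> mact V r v = mact V s v"

lemma agree_refl: "r \<approx> r"
  by (simp add: agree_def)

lemma agree_trans [trans]: "r \<approx> s \<Longrightarrow> s \<approx> t \<Longrightarrow> r \<approx> t"
  by (simp add: agree_def)

lemma agree_add: "r \<approx> r' \<Longrightarrow> s \<approx> s' \<Longrightarrow> r + s \<approx> r' + s'"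
  using left_module carrier by (simp add: agree_def left_module_def)

lemma act_mult: "mact V (r * s) v = mact V r (mact V s v)"
  using left_module carrier acted_groupD(9) by (auto simp: left_module_def)

lemma act_closed: "mact V r v \<in> mcarrier V"
  using left_module carrier acted_groupD(7) by (auto simp: left_module_def)

text \<open>The annihilator is only a left ideal, so the factor that varies has to be the right one.\<close>

lemma agree_mult: "s \<approx> s' \<Longrightarrow> r * s \<approx> r * s'"
  by (simp add: agree_def act_mult)

lemma agree_cscale: "s \<approx> s' \<Longrightarrow> c *\<^sub>c s \<approx> c *\<^sub>c s'"
  using agree_mult[of s s' "c *\<^sub>c 1"] by (simp add: cscale_mult_left)

lemma agree_diff: "r \<approx> r' \<Longrightarrow> s \<approx> s' \<Longrightarrow> r - s \<approx> r' - s'"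
  using agree_add[of r r' "- 1 * s" "- 1 * s'"] agree_mult[of s s' "- 1"] by simp

lemma agree_zero:
  "s \<approx> 0 \<Longrightarrow> c *\<^sub>c s \<approx> 0" "s \<approx> 0 \<Longrightarrow> - s \<approx> 0"
  using agree_cscale[of s 0 c] agree_diff[OF agree_refl[of 0], of s 0] by simp_all

lemma agree_mult_scalar: "s \<approx> c *\<^sub>c 1 \<Longrightarrow> r * s \<approx> c *\<^sub>c r"
  using agree_mult[of s "c *\<^sub>c 1" r] by (simp add: cscale_mult_right)

lemma act_scalar_commute:
  "s \<approx> c *\<^sub>c 1 \<Longrightarrow> mact V r (mact V s v) = mact V (c *\<^sub>c 1) (mact V r v)"
  using agree_mult_scalar[of s c r] act_mult[of "c *\<^sub>c 1" r]
  by (simp add: agree_def act_mult cscale_mult_left)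

end

section \<open>Commutators in the enveloping algebra\<close>

definition commutator :: "'a::ring \<Rightarrow> 'a \<Rightarrow> 'a" where
  "commutator a b = a * b - b * a"

lemma commutator_linear:
  fixes a :: "'a::complex_alg"
  shows "commutator a (b + b') = commutator a b + commutator a b'"
    and "commutator a (b - b') = commutator a b - commutator a b'"
    and "commutator a (c *\<^sub>c b) = c *\<^sub>c commutator a b"
  by (simp_all add: commutator_def cscale_mult_left cscale_mult_right
      cvec.scale_right_diff_distrib algebra_simps)

lemma commutator_square: "commutator a (b\<^sup>2) = commutator a b * b + b * commutator a (b :: 'a::ring_1)"
  by (simp add: commutator_def power2_eq_square algebra_simps)

abbreviation "L n \<equiv> uea_of (sv_L n)"
abbreviation "M n \<equiv> uea_of (sv_M n)"
abbreviation "Y n \<equiv> uea_of (sv_Y n)"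

lemma uea_of_linear:
  "uea_of (x + y) = uea_of x + uea_of y" "uea_of (c *\<^sub>c x) = c *\<^sub>c uea_of x"
  using assoc_lie_hom_uea_of by (auto simp: assoc_lie_hom_def Vector_Spaces.linear_iff)

lemma uea_of_zero: "uea_of 0 = 0"
  using uea_of_linear(1)[of 0 0] by simp

lemma commutator_generators:
  "commutator (L m) (L n) = (of_int n - of_int m) *\<^sub>c L (m + n)"
  "commutator (L m) (M n) = of_int n *\<^sub>c M (m + n)"
  "commutator (L m) (Y n) = (of_int n + (1 - of_int m) / 2) *\<^sub>c Y (m + n)"
  "commutator (Y m) (Y n) = (of_int n - of_int m) *\<^sub>c M (m + n + 1)"
  "commutator (M m) (M n) = 0"
  "commutator (M m) (Y n) = 0"
  "commutator (M m) (L n) = - of_int m *\<^sub>c M (n + m)"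
  "commutator (Y m) (L n) = - (of_int m + (1 - of_int n) / 2) *\<^sub>c Y (n + m)"
  "commutator (Y m) (M n) = 0"
  by (simp_all only: commutator_def flip: uea_of_bracket)
     (simp_all only: sv_brackets uea_of_linear uea_of_zero)

section \<open>The positive subalgebra and commutators killing a vector\<close>

text \<open>
  Cases are given on \<open>sv\<^sup>+\<close> itself, although spanning sets live in the ambient algebra, because the
  conditions on Whittaker vectors are about elements of the subtype.
\<close>

lemma sv_plus_induct [case_names L M Y add cscale]:
  assumes L: "\<And>n. n \<ge> 1 \<Longrightarrow> P (sv_plus_of (sv_L n))"
    and M: "\<And>n. n \<ge> 1 \<Longrightarrow> P (sv_plus_of (sv_M n))"
    and Y: "\<And>n. n \<ge> 0 \<Longrightarrow> P (sv_plus_of (sv_Y n))"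
    and add: "\<And>x y. P x \<Longrightarrow> P y \<Longrightarrow> P (x + y)"
    and cscale: "\<And>c x. P x \<Longrightarrow> P (c *\<^sub>c x)"
  shows "P x"
proof -
  have basis: "P (sv_plus_of b)" if "b \<in> sv_plus_basis" for b
    using that L M Y by (auto simp: sv_plus_basis_def)
  have "P (sv_plus_of y) \<and> y \<in> cvec.span sv_plus_basis" if "y \<in> cvec.span sv_plus_basis" for y
    using that
  proof (induction rule: cvec.span_induct_alt)
    case base
    show ?case
      using cscale[OF L[of 1], of 0] by (simp add: zero_sv_plus_def cvec.span_zero)
  next
    case (step c b y)
    have b: "b \<in> cvec.span sv_plus_basis" using step by (simp add: cvec.span_base)
    have "sv_plus_of (c *\<^sub>c b + y) = c *\<^sub>c sv_plus_of b + sv_plus_of y"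
      using b step
      by (simp add: sv_incl_inject[symmetric] plus_sv_plus.rep_eq cscale_sv_plus.rep_eq
          sv_plus_of_inverse cvec.span_add cvec.span_scale)
    then show ?case
      using b step basis add cscale by (simp add: cvec.span_add cvec.span_scale)
  qed
  from this[OF sv_incl[of x]] show ?thesis by (simp add: sv_incl_inverse)
qed

lemma sv_incl_basis:
  "n \<ge> 1 \<Longrightarrow> sv_incl (sv_plus_of (sv_L n)) = sv_L n"
  "n \<ge> 1 \<Longrightarrow> sv_incl (sv_plus_of (sv_M n)) = sv_M n"
  "n \<ge> 0 \<Longrightarrow> sv_incl (sv_plus_of (sv_Y n)) = sv_Y n"
  by (rule sv_plus_of_inverse, rule cvec.span_base, auto simp: sv_plus_basis_def)+

locale sv_module_vector = module_vector V v
  for V :: "(sv uea, 'm) lmod" and v :: 'm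
begin

text \<open>
  The vector \<open>v\<close> is an eigenvector of \<open>a\<close>, and \<open>a r v = r a v + [a, r] v\<close>.
\<close>

lemma act_on_multiple:
  assumes "commutator a r \<approx> 0" "a \<approx> c *\<^sub>c 1"
  shows "mact V a (mact V r v) = mact V (c *\<^sub>c 1) (mact V r v)"
proof -
  have "a * r \<approx> r * a"
    using agree_add[OF assms(1) agree_refl[of "r * a"]] by (simp add: commutator_def)
  then show ?thesis
    using act_scalar_commute[OF assms(2), of r] by (simp add: agree_def act_mult)
qed

definition commutes_on_sv_plus :: "sv uea \<Rightarrow> bool" where
  "commutes_on_sv_plus z \<longleftrightarrow> (\<forall>x. commutator (uea_of (sv_incl x)) z \<approx> 0)"

lemma commutes_on_sv_plusI:
  assumes "\<And>n. n \<ge> 1 \<Longrightarrow> commutator (L n) z \<approx> 0"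
    and "\<And>n. n \<ge> 1 \<Longrightarrow> commutator (M n) z \<approx> 0"
    and "\<And>n. n \<ge> 0 \<Longrightarrow> commutator (Y n) z \<approx> 0"
  shows "commutes_on_sv_plus z"
  unfolding commutes_on_sv_plus_def
proof
  fix x show "commutator (uea_of (sv_incl x)) z \<approx> 0"
  proof (induction x rule: sv_plus_induct)
    case (add x y)
    have "commutator (uea_of (sv_incl (x + y))) z =
        commutator (uea_of (sv_incl x)) z + commutator (uea_of (sv_incl y)) z"
      by (simp add: plus_sv_plus.rep_eq uea_of_linear commutator_def algebra_simps)
    then show ?case using agree_add[OF add] by simp
  next
    case (cscale c x)
    have "commutator (uea_of (sv_incl (c *\<^sub>c x))) z = c *\<^sub>c commutator (uea_of (sv_incl x)) z"
      by (simp add: cscale_sv_plus.rep_eq uea_of_linear commutator_def cscale_mult_left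
          cscale_mult_right cvec.scale_right_diff_distrib)
    then show ?case using agree_cscale[OF cscale, of c] by simp
  qed (simp_all add: sv_incl_basis assms)
qed

lemma whittaker_vector_multiple:
  assumes "whittaker_vector \<psi> V v"
    and "commutes_on_sv_plus r"
  shows "whittaker_vector \<psi> V (mact V r v)"
proof -
  have "uea_of (sv_incl x) \<approx> \<psi> x *\<^sub>c 1" for x
    using assms(1) by (simp add: whittaker_vector_def agree_def)
  then show ?thesis
    unfolding whittaker_vector_def using act_closed act_on_multiple
      assms(2)[unfolded commutes_on_sv_plus_def] by blast
qed

end

section \<open>Operators preserving Whittaker vectors\<close>

text \<open>
  All that the computations use about a Whittaker vector. The central \<open>M 0\<close> is not in \<open>sv\<^sup>+\<close>, but it is
  treated on a par with the positive basis vectors because it arises from their commutators with \<open>z\<close>.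
\<close>

locale whittaker_relations = sv_module_vector V v
  for V :: "(sv uea, 'm) lmod" and v :: 'm +
  fixes \<xi> \<eta>1 \<eta>2 \<eta>3 :: complex
  assumes L_agree: "n \<ge> 1 \<Longrightarrow> L n \<approx> (if n = 1 then \<eta>1 else if n = 2 then \<eta>2 else 0) *\<^sub>c 1"
    and M_agree: "n \<ge> 0 \<Longrightarrow> M n \<approx> (if n = 0 then \<xi> else 0) *\<^sub>c 1"
    and Y_agree: "n \<ge> 0 \<Longrightarrow> Y n \<approx> (if n = 0 then \<eta>3 else 0) *\<^sub>c 1"
begin

lemma M_agree_zero: "n \<ge> 1 \<Longrightarrow> M n \<approx> 0"
  using M_agree[of n] by simp

lemma commutes_on_sv_plus_L0:
  assumes "\<eta>1 = 0" "\<eta>2 = 0" "\<eta>3 = 0"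
  shows "commutes_on_sv_plus (L 0)"
proof -
  have "L n \<approx> 0" "M n \<approx> 0" if "n \<ge> 1" for n
    using L_agree[OF that] M_agree[of n] that by (auto simp: assms split: if_splits)
  moreover have "Y n \<approx> 0" if "n \<ge> 0" for n
    using Y_agree[OF that] by (auto simp: assms split: if_splits)
  ultimately show ?thesis
    by (intro commutes_on_sv_plusI) (auto simp: commutator_generators intro!: agree_zero)
qed

text \<open>
  Commuting with \<open>L\<^sub>0\<close> rescales a basis vector. The only basis vector of \<open>sv\<^sup>+\<close> that may fail to
  kill \<open>v\<close> is \<open>L\<^sub>1\<close>, whose contribution \<open>- \<xi> \<eta>\<^sub>1\<close> is cancelled by \<open>- \<eta>\<^sub>1 [L\<^sub>1, M\<^bsub>-1\<^esub>] = \<eta>\<^sub>1 M\<^sub>0\<close>.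
\<close>

lemma commutes_on_sv_plus_z_L1:
  assumes "\<eta>2 = 0" "\<eta>3 = 0"
  shows "commutes_on_sv_plus (\<xi> *\<^sub>c L 0 - \<eta>1 *\<^sub>c M (- 1))"
  proof (rule commutes_on_sv_plusI)
  fix n :: int assume n: "n \<ge> 1"
  have "commutator (L n) (\<xi> *\<^sub>c L 0 - \<eta>1 *\<^sub>c M (- 1)) =
      (- of_int n * \<xi>) *\<^sub>c L n + \<eta>1 *\<^sub>c M (n - 1)"
    by (simp add: commutator_linear commutator_generators cscale_cscale mult.commute)
  also have "\<dots> \<approx> (- of_int n * \<xi>) *\<^sub>c (if n = 1 then \<eta>1 else if n = 2 then \<eta>2 else 0) *\<^sub>c 1
      + \<eta>1 *\<^sub>c (if n - 1 = 0 then \<xi> else 0) *\<^sub>c 1"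
    using n by (intro agree_add agree_cscale L_agree M_agree) auto
  also have "\<dots> = 0"
    using assms by (simp add: cscale_cscale mult.commute cscale_add_left[symmetric])
  finally show "commutator (L n) (\<xi> *\<^sub>c L 0 - \<eta>1 *\<^sub>c M (- 1)) \<approx> 0" .
  show "commutator (M n) (\<xi> *\<^sub>c L 0 - \<eta>1 *\<^sub>c M (- 1)) \<approx> 0"
    using M_agree_zero[OF n] by (auto simp: commutator_linear commutator_generators intro!: agree_zero)
next
  fix n :: int assume n: "n \<ge> 0"
  show "commutator (Y n) (\<xi> *\<^sub>c L 0 - \<eta>1 *\<^sub>c M (- 1)) \<approx> 0"
    using Y_agree[OF n] assms
    by (auto simp: commutator_linear commutator_generators intro!: agree_zero split: if_splits)
qed

text \<open>
  At \<open>L\<^sub>1\<close> the terms in \<open>M\<^bsub>-1\<^esub>\<close> cancel because \<open>M\<^bsub>-1\<^esub> M\<^sub>0\<close> acts as \<open>\<xi> M\<^bsub>-1\<^esub>\<close>, and the two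
  scalars \<open>\<xi> \<eta>\<^sub>3\<^sup>2 / 2\<close> coming from \<open>Y\<^bsub>-1/2\<^esub>\<close> and \<open>M\<^bsub>-1\<^esub>\<close> cancel each other.
\<close>

lemma commutes_on_sv_plus_z_general:
  "commutes_on_sv_plus (\<xi>\<^sup>2 *\<^sub>c L 0 - (\<xi> * \<eta>2) *\<^sub>c M (- 2) - (\<xi> * \<eta>1) *\<^sub>c M (- 1) + \<eta>2 *\<^sub>c (M (- 1))\<^sup>2
            - (\<xi> * \<eta>3 / 2) *\<^sub>c Y (- 1) + (\<eta>3\<^sup>2 / 2) *\<^sub>c M (- 1))" (is "commutes_on_sv_plus ?z")
  proof (rule commutes_on_sv_plusI)
  fix n :: int assume n: "n \<ge> 1"
  have comm: "M (n - 1) * M (- 1) = M (- 1) * M (n - 1)"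
    using commutator_generators(5)[of "n - 1" "- 1"] by (simp add: commutator_def)
  have eq: "commutator (L n) ?z =
      (- of_int n * \<xi>\<^sup>2) *\<^sub>c L n
      + (2 * \<xi> * \<eta>2) *\<^sub>c M (n - 2) - (2 * \<eta>2) *\<^sub>c (M (- 1) * M (n - 1))
      + (\<xi> * \<eta>3 * (of_int n + 1) / 4) *\<^sub>c Y (n - 1) + (\<xi> * \<eta>1 - \<eta>3\<^sup>2 / 2) *\<^sub>c M (n - 1)"
  proof -
    have sq: "commutator (L n) ((M (- 1))\<^sup>2) = - (2 :: complex) *\<^sub>c (M (- 1) * M (n - 1))"
      using cscale_add_left[of 1 1 "M (- 1) * M (n - 1)"]
      by (simp add: commutator_square commutator_generators cscale_mult_left cscale_mult_right comm
          cscale_one)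
    have y: "- (\<xi> * \<eta>3 / 2 * (of_int (- 1) + (1 - of_int n) / 2)) = \<xi> * \<eta>3 * (of_int n + 1) / 4"
      by (simp add: field_simps)
    show ?thesis
      unfolding y[symmetric]
      by (simp only: commutator_linear sq commutator_generators cscale_cscale)
         (simp add: cvec.scale_left_diff_distrib cvec.scale_minus_left algebra_simps)
  qed
  \<comment> \<open>Only for \<open>n = 1\<close> is there a term, \<open>M (- 1)\<close>, that is not a scalar modulo the annihilator;
    for \<open>n \<ge> 2\<close> the factor \<open>M (n - 1)\<close> is positive and kills \<open>v\<close>.\<close>
  show "commutator (L n) ?z \<approx> 0"
  proof (cases "n = 1")
    case True
    have "commutator (L n) ?z \<approx> (- of_int n * \<xi>\<^sup>2) *\<^sub>c \<eta>1 *\<^sub>c 1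
      + (2 * \<xi> * \<eta>2) *\<^sub>c M (- 1) - (2 * \<eta>2) *\<^sub>c \<xi> *\<^sub>c M (- 1)
      + (\<xi> * \<eta>3 * (of_int n + 1) / 4) *\<^sub>c \<eta>3 *\<^sub>c 1 + (\<xi> * \<eta>1 - \<eta>3\<^sup>2 / 2) *\<^sub>c \<xi> *\<^sub>c 1"
      unfolding eq using L_agree[of n] M_agree[of "n - 1"] Y_agree[of "n - 1"] True
      by (intro agree_add agree_diff agree_cscale agree_mult_scalar) (simp_all add: agree_refl)
    also have "\<dots> = (- of_int n * \<xi>\<^sup>2 * \<eta>1 + \<xi> * \<eta>3 * (of_int n + 1) / 4 * \<eta>3
        + (\<xi> * \<eta>1 - \<eta>3\<^sup>2 / 2) * \<xi>) *\<^sub>c 1"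
      by (simp add: cscale_cscale cscale_add_left cvec.scale_left_diff_distrib mult_ac)
    also have "\<dots> = 0"
      using True by (simp add: power2_eq_square algebra_simps)
    finally show ?thesis .
  next
    case False
    with n have n2: "n \<ge> 2" by simp
    have "commutator (L n) ?z \<approx> (- of_int n * \<xi>\<^sup>2) *\<^sub>c (if n = 2 then \<eta>2 else 0) *\<^sub>c 1
      + (2 * \<xi> * \<eta>2) *\<^sub>c (if n - 2 = 0 then \<xi> else 0) *\<^sub>c 1 - (2 * \<eta>2) *\<^sub>c 0 *\<^sub>c M (- 1)
      + (\<xi> * \<eta>3 * (of_int n + 1) / 4) *\<^sub>c 0 *\<^sub>c 1 + (\<xi> * \<eta>1 - \<eta>3\<^sup>2 / 2) *\<^sub>c 0 *\<^sub>c 1"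
      unfolding eq using L_agree[of n] M_agree[of "n - 1"] M_agree[of "n - 2"] Y_agree[of "n - 1"] n2
      by (intro agree_add agree_diff agree_cscale agree_mult_scalar) (simp_all add: agree_refl)
    also have "\<dots> = 0"
      by (simp add: cscale_cscale cscale_add_left[symmetric] power2_eq_square)
    finally show ?thesis .
  qed
  have "commutator (M n) ?z = (- of_int n * \<xi>\<^sup>2) *\<^sub>c M n"
    by (simp add: commutator_linear commutator_generators commutator_square cscale_cscale mult.commute)
  then show "commutator (M n) ?z \<approx> 0"
    using M_agree_zero[OF n] by (simp add: agree_zero)
next
  fix n :: int assume n: "n \<ge> 0"
  have "commutator (Y n) ?z = (- (of_int n + 1 / 2) * \<xi>\<^sup>2) *\<^sub>c Y n
      + (\<xi> * \<eta>3 * (of_int n + 1) / 2) *\<^sub>c M n"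
  proof -
    have y: "- (\<xi> * \<eta>3 / 2 * (of_int (- 1) - of_int n)) = \<xi> * \<eta>3 * (of_int n + 1) / 2"
      by (simp add: field_simps)
    show ?thesis
      unfolding y[symmetric]
      by (simp add: commutator_linear commutator_generators commutator_square cscale_cscale
          cvec.scale_minus_left mult.commute)
  qed
  also have "\<dots> \<approx> (- (of_int n + 1 / 2) * \<xi>\<^sup>2) *\<^sub>c (if n = 0 then \<eta>3 else 0) *\<^sub>c 1
      + (\<xi> * \<eta>3 * (of_int n + 1) / 2) *\<^sub>c (if n = 0 then \<xi> else 0) *\<^sub>c 1"
    using n by (intro agree_add agree_cscale Y_agree M_agree)
  also have "\<dots> = 0"
    by (simp add: cscale_cscale cscale_add_left[symmetric] power2_eq_square)
  finally show "commutator (Y n) ?z \<approx> 0" .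
qed

end

section \<open>The cyclic Whittaker vector and polynomials in z\<close>

lemma whittaker_vector_z:
  fixes \<psi> :: "sv_plus \<Rightarrow> complex"
  assumes V: "left_module V"
    and central: "\<And>v. v \<in> mcarrier V \<Longrightarrow> mact V (M 0) v = mact V (\<xi> *\<^sub>c 1) v"
    and psi_L: "\<And>n. n \<ge> 3 \<Longrightarrow> \<psi> (sv_plus_of (sv_L n)) = 0"
    and psi_M: "\<And>m. m \<ge> 1 \<Longrightarrow> \<psi> (sv_plus_of (sv_M m)) = 0"
    and psi_Y: "\<And>k. k \<ge> 1 \<Longrightarrow> \<psi> (sv_plus_of (sv_Y k)) = 0"
    and v: "whittaker_vector \<psi> V v"
  shows "whittaker_vector \<psi> V (mact V (whittaker_z \<psi> \<xi>) v)"
proof -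
  let ?\<eta>1 = "\<psi> (sv_plus_of (sv_L 1))" and ?\<eta>2 = "\<psi> (sv_plus_of (sv_L 2))"
    and ?\<eta>3 = "\<psi> (sv_plus_of (sv_Y 0))" and ?z = "whittaker_z \<psi> \<xi>"
  interpret sv_module_vector V v
    using V v by unfold_locales (simp_all add: whittaker_vector_def)
  have agree: "uea_of (sv_incl x) \<approx> \<psi> x *\<^sub>c 1" for x
    using v by (simp add: whittaker_vector_def agree_def)
  interpret whittaker_relations V v \<xi> ?\<eta>1 ?\<eta>2 ?\<eta>3
  proof unfold_locales
    fix n :: int
    show "n \<ge> 1 \<Longrightarrow> L n \<approx> (if n = 1 then ?\<eta>1 else if n = 2 then ?\<eta>2 else 0) *\<^sub>c 1"
      using agree[of "sv_plus_of (sv_L n)"] psi_L[of n] by (auto simp: sv_incl_basis)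
    show "n \<ge> 0 \<Longrightarrow> M n \<approx> (if n = 0 then \<xi> else 0) *\<^sub>c 1"
      using agree[of "sv_plus_of (sv_M n)"] psi_M[of n] central[OF carrier]
      by (auto simp: sv_incl_basis agree_def)
    show "n \<ge> 0 \<Longrightarrow> Y n \<approx> (if n = 0 then ?\<eta>3 else 0) *\<^sub>c 1"
      using agree[of "sv_plus_of (sv_Y n)"] psi_Y[of n] by (auto simp: sv_incl_basis)
  qed
  have "commutes_on_sv_plus ?z"
    unfolding whittaker_z_def Let_def
    using commutes_on_sv_plus_L0 commutes_on_sv_plus_z_L1 commutes_on_sv_plus_z_general by simp
  then show ?thesis
    by (rule whittaker_vector_multiple[OF v])
qed

text \<open>
  The hypothesis is about all Whittaker vectors, not one, so that it can be applied again to the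
  result; this is what makes products go through.
\<close>

lemma whittaker_vector_subalgebra:
  assumes V: "left_module V"
    and S: "\<And>z v. z \<in> S \<Longrightarrow> whittaker_vector \<psi> V v \<Longrightarrow> whittaker_vector \<psi> V (mact V z v)"
    and u: "u \<in> subalgebra_gen S" and v: "whittaker_vector \<psi> V v"
  shows "whittaker_vector \<psi> V (mact V u v)"
  using u v
proof (induction arbitrary: v)
  case (scalar c)
  interpret sv_module_vector V v
    using V scalar by unfold_locales (simp_all add: whittaker_vector_def)
  have "commutes_on_sv_plus (c *\<^sub>c 1)"
    by (simp add: commutes_on_sv_plus_def commutator_def cscale_mult_left cscale_mult_right agree_refl)
  then show ?case
    by (rule whittaker_vector_multiple[OF scalar])
next
  case (add a b)
  interpret sv_module_vector V v
    using V add by unfold_locales (simp_all add: whittaker_vector_def)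
  note A = acted_groupD[OF V[unfolded left_module_def, THEN conjunct1]]
  have "mact V (a + b) v = madd V (mact V a v) (mact V b v)"
    using V carrier by (simp add: left_module_def)
  then show ?case
    using add.IH[OF add.prems] by (simp add: whittaker_vector_def A(2,8))
next
  case (mult a b)
  interpret sv_module_vector V v
    using V mult by unfold_locales (simp_all add: whittaker_vector_def)
  show ?case
    using mult by (simp add: act_mult)
qed (rule S)

text \<open>Since \<open>M\<^sub>0 x = \<xi> x + (M\<^sub>0 - \<xi>) x\<close>, the two cosets differ by an element of the submodule.\<close>

lemma central_action_L_psi:
  assumes "X \<in> mcarrier (L_psi \<psi> \<xi>)"
  shows "mact (L_psi \<psi> \<xi>) (M 0) X = mact (L_psi \<psi> \<xi>) (\<xi> *\<^sub>c 1) X"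
proof -
  let ?W = "W_psi \<psi>" and ?N = "central_sub \<psi> \<xi>"
  have A: "acted_group ?W" using left_module_W_psi by (simp add: left_module_def)
  note A' = acted_groupD[OF A]
  obtain x where x: "x \<in> mcarrier ?W" "X = mcoset ?W ?N x"
    using assms by (auto simp: L_psi_def quot_simps)
  have "mact ?W (\<xi> *\<^sub>c 1 + (M 0 - \<xi> *\<^sub>c 1)) x =
      madd ?W (mact ?W (\<xi> *\<^sub>c 1) x) (mact ?W (M 0 - \<xi> *\<^sub>c 1) x)"
    using left_module_W_psi x(1) unfolding left_module_def by blast
  moreover have "mact ?W (M 0 - \<xi> *\<^sub>c 1) x \<in> ?N"
    using x(1) by (simp add: central_sub_def)
  ultimately have "mcoset ?W ?N (mact ?W (M 0) x) = mcoset ?W ?N (mact ?W (\<xi> *\<^sub>c 1) x)"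
    using mcoset_eqI[OF A submodule_central_sub A'(7)[OF x(1)]] by simp
  then show ?thesis
    by (simp add: x L_psi_def mact_quot[OF A submodule_central_sub])
qed

lemma pure_tensor_balanced:
  fixes f :: "'s \<Rightarrow> 'r::ring_1"
  assumes cl: "\<And>s x. x \<in> mcarrier V \<Longrightarrow> mact V s x \<in> mcarrier V"
    "\<And>x y. x \<in> mcarrier V \<Longrightarrow> y \<in> mcarrier V \<Longrightarrow> madd V x y \<in> mcarrier V"
    and a: "a \<in> mcarrier V"
  shows "pure_tensor f V (u * f s) a = pure_tensor f V u (mact V s a)"
proof -
  let ?P = "pair_group V :: ('r, _) lmod"
  have "frag_of (u * f s, a) - frag_of (u, mact V s a) \<in> tensor_relations f V"
    unfolding tensor_relations_def using a by (blast intro: group_closure.base)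
  moreover have "frag_of (u, mact V s a) \<in> mcarrier ?P"
    using cl a by (simp add: pair_group_def)
  ultimately have "mcoset ?P (tensor_relations f V) (madd ?P (frag_of (u, mact V s a))
      (frag_of (u * f s, a) - frag_of (u, mact V s a))) = pure_tensor f V u (mact V s a)"
    unfolding pure_tensor_def
    using mcoset_eqI[OF acted_group_pair submodule_tensor_relations[OF cl]] by blast
  then show ?thesis by (simp add: pair_group_def pure_tensor_def)
qed

lemma act_pure_tensor:
  fixes f :: "'s \<Rightarrow> 'r::ring_1"
  assumes cl: "\<And>s x. x \<in> mcarrier V \<Longrightarrow> mact V s x \<in> mcarrier V"
    "\<And>x y. x \<in> mcarrier V \<Longrightarrow> y \<in> mcarrier V \<Longrightarrow> madd V x y \<in> mcarrier V"
    and a: "a \<in> mcarrier V"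
  shows "mact (ext_scalars f V) r (pure_tensor f V u a) = pure_tensor f V (r * u) a"
  unfolding ext_scalars_def pure_tensor_def
  using a by (subst mact_quot[OF acted_group_pair submodule_tensor_relations[OF cl]])
    (simp_all add: pair_group_def)

text \<open>
  Both \<open>x \<otimes> 1\<close> and \<open>\<psi>(x) 1 \<otimes> 1\<close> are equal to \<open>1 \<otimes> \<psi>(x)\<close>, as \<open>x\<close> and \<open>\<psi>(x) 1\<close> both come from
  \<open>U(sv\<^sup>+)\<close> and act on the one-dimensional module by \<open>\<psi>(x)\<close>. The Lie bracket of \<open>\<complex>\<close> and the
  commutator of the algebra \<open>\<complex>\<close> are both zero, so \<open>\<psi>\<close> extends to the enveloping algebra.
\<close>

lemma whittaker_vector_w_bar:
  assumes hom: "lie_hom \<psi>"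
  shows "whittaker_vector \<psi> (L_psi \<psi> \<xi>) (w_bar \<psi> \<xi>)"
proof -
  let ?W = "W_psi \<psi>" and ?N = "central_sub \<psi> \<xi>" and ?t = "pure_tensor uea_incl (C_psi \<psi>)"
  have A: "acted_group ?W" using left_module_W_psi by (simp add: left_module_def)
  have cl: "mact (C_psi \<psi>) s x \<in> mcarrier (C_psi \<psi>)" "madd (C_psi \<psi>) x y \<in> mcarrier (C_psi \<psi>)"
    for s x y by (simp_all add: C_psi_def)
  have psi: "assoc_lie_hom \<psi>"
    using hom by (simp add: lie_hom_def assoc_lie_hom_def bracket_complex_def mult.commute)
  have incl: "assoc_lie_hom (\<lambda>x. uea_of (sv_incl x))"
    by (auto simp: assoc_lie_hom_def Vector_Spaces.linear_iff plus_sv_plus.rep_eq cscale_sv_plus.rep_eq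
        bracket_sv_plus.rep_eq uea_of_linear uea_of_bracket intro: cvec.vector_space_axioms)
  have t: "?t 1 1 \<in> mcarrier ?W"
    by (simp add: W_psi_def ext_scalars_def quot_simps pure_tensor_def pair_group_def C_psi_def)
  have act: "mact ?W r (?t 1 1) = ?t r 1" for r
    unfolding W_psi_def by (subst act_pure_tensor) (simp_all add: C_psi_def)
  have move: "?t (uea_incl s) 1 = ?t 1 (uea_lift \<psi> s)" for s
    using pure_tensor_balanced[of "C_psi \<psi>" 1 uea_incl 1 s] by (simp add: C_psi_def)
  have "?t (uea_of (sv_incl x)) 1 = ?t (\<psi> x *\<^sub>c 1) 1" for x
    using move[of "uea_of x"] move[of "\<psi> x *\<^sub>c 1"]
    by (simp add: uea_incl_def uea_lift[OF psi] uea_lift[OF incl] cscale_complex_def)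
  then show ?thesis
    using t
    by (simp add: whittaker_vector_def L_psi_def w_bar_def mact_quot[OF A submodule_central_sub] act
        quot_simps)
qed

theorem proposition5p2:
  fixes \<psi> :: "sv_plus \<Rightarrow> complex" and \<xi> :: complex and u :: "sv uea"
  assumes hom: "lie_hom \<psi>"
    and psi_L: "\<And>n. n \<ge> 3 \<Longrightarrow> \<psi> (sv_plus_of (sv_L n)) = 0"
    and psi_M: "\<And>m. m \<ge> 2 \<Longrightarrow> \<psi> (sv_plus_of (sv_M m)) = 0"
    and psi_Y: "\<And>k. k \<ge> 1 \<Longrightarrow> \<psi> (sv_plus_of (sv_Y k)) = 0"
    and psi_M1: "\<psi> (sv_plus_of (sv_M 1)) = 0"
    and u: "u \<in> subalgebra_gen {whittaker_z \<psi> \<xi>}"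
  shows "whittaker_vector \<psi> (L_psi \<psi> \<xi>) (mact (L_psi \<psi> \<xi>) u (w_bar \<psi> \<xi>))"
proof (rule whittaker_vector_subalgebra[OF left_module_L_psi _ u whittaker_vector_w_bar[OF hom]])
  have M: "\<psi> (sv_plus_of (sv_M m)) = 0" if "m \<ge> 1" for m
    using psi_M[of m] psi_M1 that by (cases "m = 1") auto
  fix z X assume "z \<in> {whittaker_z \<psi> \<xi>}" "whittaker_vector \<psi> (L_psi \<psi> \<xi>) X"
  then show "whittaker_vector \<psi> (L_psi \<psi> \<xi>) (mact (L_psi \<psi> \<xi>) z X)"
    using whittaker_vector_z[OF left_module_L_psi central_action_L_psi, of \<psi>] psi_L M psi_Y
    by simp
qed

end
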